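(* Let $W=M_uC_\varphi$ be a bounded weighted composition operator on $L^2(\mu)$ with closed range, let $J=J_1=hE(|u|^2)\circ\varphi^{-1}$, and suppose $\varphi^{-1}(S(J))\subseteq S(J)$. Then there exists $\delta>0$ such that $J_n\geq\delta^n$ $\mu$-a.e. on $S(J)$ for all $n\in\mathbb{N}$. In case $S(J)=X$, for all $n\in\mathbb{N}$ the operator $W^n$, and equivalently $(W^* )^n$, has closed range.
   Context: $(X,\mathcal{F},\mu)$ is a $\sigma$-finite measure space, $L^2(\mu)$ is the complex $L^2$ space, $\varphi:X\to X$ is a non-singular measurable transformation (i.e. $\mu\circ\varphi^{-1}\ll\mu$), and $u:X\to[0,\infty)$ is measurable. The weighted composition operator is $Wf=M_uC_\varphi f=u\cdot(f\circ\varphi)$. For $n\in\mathbb{N}$, let $h_n=\frac{d\mu\circ\varphi^{-n}}{d\mu}$ be the Radon-Nikodym derivative, $u_n=\prod_{k=0}^{n-1}u\circ\varphi^k$, $E_n$ the conditional expectation with respect to the $\sigma$-subalgebra $\varphi^{-n}(\mathcal{F})$, and $J_n=h_nE_n(|u_n|^2)\circ\varphi^{-n}$, where if $E_n(f)=g\circ\varphi^n$ then $h_nE_n(f)\circ\varphi^{-n}$ denotes $h_n\cdot g$. Thus $J_n$ is the ($\mu$-a.e. unique) nonnegative measurable function with $\int_A J_n\,d\mu=\int_{\varphi^{-n}(A)}|u_n|^2\,d\mu$ for all $A\in\mathcal{F}$. Write $h=h_1$, $E=E_1$, $J=J_1$. For a measurable function $f$, $S(f)=\{x\in X: f(x)\neq0\}$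 is its support; equalities and inclusions of such sets are understood up to $\mu$-null sets. *)

theory Defs
  imports "HOL-Probability.Probability"
begin

section \<open>The space \<open>L\<^sup>2(\<mu>)\<close>\<close>

text \<open>Elements of complex \<open>L\<^sup>2(\<mu>)\<close> are honest classes of square-integrable measurable functions
  modulo equality almost everywhere. Operators on \<open>L\<^sup>2(\<mu>)\<close> are functions on classes of which
  only the values on the carrier \<open>L2 M\<close> matter.\<close>

definition sq_integrable :: "'a measure \<Rightarrow> ('a \<Rightarrow> complex) set" where
  "sq_integrable M = {f \<in> borel_measurable M. integrable M (\<lambda>x. (cmod (f x))\<^sup>2)}"

definition ae_class :: "'a measure \<Rightarrow> ('a \<Rightarrow> complex) \<Rightarrow> ('a \<Rightarrow> complex) set" where
  "ae_class M f = {g \<in> borel_measurable M. AE x in M. g x = f x}"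

definition L2 :: "'a measure \<Rightarrow> ('a \<Rightarrow> complex) set set" where
  "L2 M = ae_class M ` sq_integrable M"

definition rep :: "('a \<Rightarrow> complex) set \<Rightarrow> 'a \<Rightarrow> complex" where
  "rep F = (SOME f. f \<in> F)"

definition l2_inner :: "'a measure \<Rightarrow> ('a \<Rightarrow> complex) set \<Rightarrow> ('a \<Rightarrow> complex) set \<Rightarrow> complex" where
  "l2_inner M F G = (\<integral>x. rep F x * cnj (rep G x) \<partial>M)"

definition l2_norm :: "'a measure \<Rightarrow> ('a \<Rightarrow> complex) set \<Rightarrow> real" where
  "l2_norm M F = sqrt (\<integral>x. (cmod (rep F x))\<^sup>2 \<partial>M)"

definition l2_dist :: "'a measure \<Rightarrow> ('a \<Rightarrow> complex) set \<Rightarrow> ('a \<Rightarrow> complex) set \<Rightarrow> real" where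
  "l2_dist M F G = sqrt (\<integral>x. (cmod (rep F x - rep G x))\<^sup>2 \<partial>M)"

definition bounded_l2_op ::
    "'a measure \<Rightarrow> (('a \<Rightarrow> complex) set \<Rightarrow> ('a \<Rightarrow> complex) set) \<Rightarrow> bool" where
  "bounded_l2_op M T \<longleftrightarrow>
     T ` L2 M \<subseteq> L2 M \<and> (\<exists>C. \<forall>F \<in> L2 M. l2_norm M (T F) \<le> C * l2_norm M F)"

definition has_closed_range ::
    "'a measure \<Rightarrow> (('a \<Rightarrow> complex) set \<Rightarrow> ('a \<Rightarrow> complex) set) \<Rightarrow> bool" where
  "has_closed_range M T \<longleftrightarrow> closedin (Metric_space.mtopology (L2 M) (l2_dist M)) (T ` L2 M)"

definition l2_adjoint ::
    "'a measure \<Rightarrow> (('a \<Rightarrow> complex) set \<Rightarrow> ('a \<Rightarrow> complex) set)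
       \<Rightarrow> ('a \<Rightarrow> complex) set \<Rightarrow> ('a \<Rightarrow> complex) set" where
  "l2_adjoint M T G =
     (THE H. H \<in> L2 M \<and> (\<forall>F \<in> L2 M. l2_inner M (T F) G = l2_inner M F H))"


section \<open>Weighted composition operators\<close>

definition wco ::
    "'a measure \<Rightarrow> ('a \<Rightarrow> real) \<Rightarrow> ('a \<Rightarrow> 'a) \<Rightarrow> ('a \<Rightarrow> complex) set \<Rightarrow> ('a \<Rightarrow> complex) set" where
  "wco M u \<phi> F = ae_class M (\<lambda>x. complex_of_real (u x) * rep F (\<phi> x))"

definition nonsingular :: "'a measure \<Rightarrow> ('a \<Rightarrow> 'a) \<Rightarrow> bool" where
  "nonsingular M \<phi> \<longleftrightarrow> \<phi> \<in> measurable M M \<and> absolutely_continuous M (distr M M \<phi>)"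

definition weight :: "('a \<Rightarrow> real) \<Rightarrow> ('a \<Rightarrow> 'a) \<Rightarrow> nat \<Rightarrow> 'a \<Rightarrow> real" where
  "weight u \<phi> n x = (\<Prod>k<n. u ((\<phi> ^^ k) x))"

definition rn_h :: "'a measure \<Rightarrow> ('a \<Rightarrow> 'a) \<Rightarrow> nat \<Rightarrow> 'a \<Rightarrow> ennreal" where
  "rn_h M \<phi> n = RN_deriv M (distr M M (\<phi> ^^ n))"

definition cond_E :: "'a measure \<Rightarrow> ('a \<Rightarrow> 'a) \<Rightarrow> nat \<Rightarrow> ('a \<Rightarrow> ennreal) \<Rightarrow> 'a \<Rightarrow> ennreal" where
  "cond_E M \<phi> n = nn_cond_exp M (vimage_algebra (space M) (\<phi> ^^ n) M)"

text \<open>\<open>J\<^sub>n\<close> is the nonnegative measurable function with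
  \<open>\<integral>\<^sub>A J\<^sub>n d\<mu> = \<integral>\<^bsub>\<phi>\<^sup>-\<^sup>n(A)\<^esub> |u\<^sub>n|\<^sup>2 d\<mu>\<close> for all measurable \<open>A\<close> (lemma \<open>set_nn_integral_wco_J\<close>; unique a.e. by
  \<open>wco_J_unique\<close>). Whenever the conditional expectation with respect to \<open>\<phi>\<^sup>-\<^sup>n(\<F>)\<close> exists,
  i.e. \<open>\<mu>\<close> is \<open>\<sigma>\<close>-finite there, \<open>J\<^sub>n = h\<^sub>n \<cdot> g\<close> for every \<open>g\<close> with
  \<open>E\<^sub>n(|u\<^sub>n|\<^sup>2) = g \<circ> \<phi>\<^sup>n\<close> (lemma \<open>wco_J_eq_h_E\<close>).\<close>

definition wco_J :: "'a measure \<Rightarrow> ('a \<Rightarrow> real) \<Rightarrow> ('a \<Rightarrow> 'a) \<Rightarrow> nat \<Rightarrow> 'a \<Rightarrow> ennreal" where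
  "wco_J M u \<phi> n =
     RN_deriv M (distr (density M (\<lambda>x. ennreal (\<bar>weight u \<phi> n x\<bar>\<^sup>2))) M (\<phi> ^^ n))"

definition supp :: "'a measure \<Rightarrow> ('a \<Rightarrow> 'b::zero) \<Rightarrow> 'a set" where
  "supp M f = {x \<in> space M. f x \<noteq> 0}"


section \<open>Sanity checks\<close>

lemma rep_L2:
  assumes "F \<in> L2 M"
  shows "rep F \<in> sq_integrable M" and "ae_class M (rep F) = F"
proof -
  obtain f where f: "f \<in> sq_integrable M" "F = ae_class M f"
    using assms by (auto simp: L2_def)
  then have "f \<in> F"
    by (auto simp: ae_class_def sq_integrable_def)
  then have "rep F \<in> F"
    unfolding rep_def by (rule someI[of "\<lambda>f. f \<in> F" f])
  then have r: "rep F \<in> borel_measurable M" and ae: "AE x in M. rep F x = f x"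
    using f by (auto simp: ae_class_def)
  have fm: "f \<in> borel_measurable M" and fi: "integrable M (\<lambda>x. (cmod (f x))\<^sup>2)"
    using f by (auto simp: sq_integrable_def)
  have "integrable M (\<lambda>x. (cmod (rep F x))\<^sup>2)"
    by (rule integrable_cong_AE_imp[OF fi]) (use r ae fm in auto)
  then show "rep F \<in> sq_integrable M"
    using r by (simp add: sq_integrable_def)
  show "ae_class M (rep F) = F"
    using ae unfolding f ae_class_def by (auto elim: AE_mp)
qed

lemma rep_ae_class:
  assumes "f \<in> borel_measurable M"
  shows "rep (ae_class M f) \<in> borel_measurable M" and "AE x in M. rep (ae_class M f) x = f x"
proof -
  have "f \<in> ae_class M f"
    using assms by (auto simp: ae_class_def)
  then have "rep (ae_class M f) \<in> ae_class M f"
    unfolding rep_def by (rule someI[of "\<lambda>g. g \<in> ae_class M f" f])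
  then show "rep (ae_class M f) \<in> borel_measurable M" and "AE x in M. rep (ae_class M f) x = f x"
    by (auto simp: ae_class_def)
qed

lemma ae_class_cong:
  assumes "AE x in M. f x = g x"
  shows "ae_class M f = ae_class M g"
  using assms unfolding ae_class_def by (auto elim: AE_mp)

lemma nonsingular_AE:
  assumes "nonsingular M \<phi>" and "AE x in M. P x"
  shows "AE x in M. P (\<phi> x)"
proof -
  have m: "\<phi> \<in> measurable M M" and ac: "absolutely_continuous M (distr M M \<phi>)"
    using assms(1) by (auto simp: nonsingular_def)
  have "AE x in distr M M \<phi>. P x"
    by (rule absolutely_continuous_AE[OF _ ac assms(2)]) simp
  then show ?thesis
    using m by (rule AE_distrD[rotated])
qed

lemma nonsingular_funpow:
  assumes "nonsingular M \<phi>"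
  shows "nonsingular M (\<phi> ^^ n)"
proof (induction n)
  case 0
  show ?case
    by (simp add: nonsingular_def absolutely_continuous_def distr_id[unfolded id_def] id_def)
next
  case (Suc n)
  have m: "\<phi> \<in> measurable M M" "\<phi> ^^ n \<in> measurable M M"
    using assms Suc by (auto simp: nonsingular_def)
  then have m': "\<phi> ^^ Suc n \<in> measurable M M"
    by (simp add: measurable_comp[unfolded comp_def] comp_def)
  show ?case
    unfolding nonsingular_def absolutely_continuous_def
  proof (intro conjI subsetI m')
    fix A assume A: "A \<in> null_sets M"
    then have "AE x in M. x \<notin> A"
      by (rule AE_not_in)
    from nonsingular_AE[OF Suc nonsingular_AE[OF assms this]]
    have "AE x in M. (\<phi> ^^ Suc n) x \<notin> A"
      by simp
    then have "AE x in distr M M (\<phi> ^^ Suc n). x \<notin> A"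
      using m' A by (subst AE_distr_iff) auto
    then show "A \<in> null_sets (distr M M (\<phi> ^^ Suc n))"
      using A by (subst (asm) AE_iff_null_sets[symmetric]) auto
  qed
qed

text \<open>By nonsingularity, \<open>wco\<close> does not depend on the chosen representatives.\<close>

lemma wco_ae_class:
  assumes "nonsingular M \<phi>" and "f \<in> borel_measurable M"
  shows "wco M u \<phi> (ae_class M f) = ae_class M (\<lambda>x. complex_of_real (u x) * f (\<phi> x))"
  unfolding wco_def
  by (rule ae_class_cong)
     (use nonsingular_AE[OF assms(1) rep_ae_class(2)[OF assms(2)]] in auto)

lemma borel_measurable_weight:
  assumes "nonsingular M \<phi>" and "u \<in> borel_measurable M"
  shows "weight u \<phi> n \<in> borel_measurable M"
proof -
  have "\<phi> ^^ k \<in> measurable M M" for k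
    using nonsingular_funpow[OF assms(1)] by (simp add: nonsingular_def)
  then have "(\<lambda>x. u ((\<phi> ^^ k) x)) \<in> borel_measurable M" for k
    using assms(2) by (rule measurable_compose)
  then show ?thesis
    unfolding weight_def[abs_def] by (intro borel_measurable_prod)
qed

context sigma_finite_measure
begin

lemma density_wco_J:
  assumes "nonsingular M \<phi>" and "u \<in> borel_measurable M"
  shows "density M (wco_J M u \<phi> n) =
    distr (density M (\<lambda>x. ennreal (\<bar>weight u \<phi> n x\<bar>\<^sup>2))) M (\<phi> ^^ n)"
  unfolding wco_J_def
proof (rule density_RN_deriv)
  have w [measurable]: "weight u \<phi> n \<in> borel_measurable M"
    by (rule borel_measurable_weight[OF assms])
  have p [measurable]: "\<phi> ^^ n \<in> measurable M M"
    using nonsingular_funpow[OF assms(1)] by (simp add: nonsingular_def)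
  show "absolutely_continuous M (distr (density M (\<lambda>x. ennreal (\<bar>weight u \<phi> n x\<bar>\<^sup>2))) M (\<phi> ^^ n))"
    unfolding absolutely_continuous_def
  proof
    fix A assume A: "A \<in> null_sets M"
    then have [measurable]: "A \<in> sets M" by auto
    from A have "AE x in M. (\<phi> ^^ n) x \<notin> A"
      by (intro nonsingular_AE[OF nonsingular_funpow[OF assms(1)]] AE_not_in)
    then have "AE x in distr (density M (\<lambda>x. ennreal (\<bar>weight u \<phi> n x\<bar>\<^sup>2))) M (\<phi> ^^ n). x \<notin> A"
      by (subst AE_distr_iff) (auto simp: AE_density)
    then show "A \<in> null_sets (distr (density M (\<lambda>x. ennreal (\<bar>weight u \<phi> n x\<bar>\<^sup>2))) M (\<phi> ^^ n))"
      by (subst (asm) AE_iff_null_sets[symmetric]) auto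
  qed
qed simp

lemma set_nn_integral_wco_J:
  assumes "nonsingular M \<phi>" and "u \<in> borel_measurable M" and "A \<in> sets M"
  shows "(\<integral>\<^sup>+x\<in>A. wco_J M u \<phi> n x \<partial>M) =
    (\<integral>\<^sup>+x\<in>(\<phi> ^^ n) -` A \<inter> space M. ennreal (\<bar>weight u \<phi> n x\<bar>\<^sup>2) \<partial>M)"
proof -
  have w [measurable]: "weight u \<phi> n \<in> borel_measurable M"
    by (rule borel_measurable_weight[OF assms(1,2)])
  have p [measurable]: "\<phi> ^^ n \<in> measurable M M"
    using nonsingular_funpow[OF assms(1)] by (simp add: nonsingular_def)
  have "(\<integral>\<^sup>+x\<in>A. wco_J M u \<phi> n x \<partial>M) = emeasure (density M (wco_J M u \<phi> n)) A"
    using assms(3) by (subst emeasure_density) (auto simp: wco_J_def)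
  also have "\<dots> = emeasure (density M (\<lambda>x. ennreal (\<bar>weight u \<phi> n x\<bar>\<^sup>2))) ((\<phi> ^^ n) -` A \<inter> space M)"
    using assms(3) by (simp add: density_wco_J[OF assms(1,2)] emeasure_distr)
  also have "\<dots> = (\<integral>\<^sup>+x\<in>(\<phi> ^^ n) -` A \<inter> space M. ennreal (\<bar>weight u \<phi> n x\<bar>\<^sup>2) \<partial>M)"
    using assms(3) by (subst emeasure_density) auto
  finally show ?thesis .
qed

lemma wco_J_unique:
  assumes "nonsingular M \<phi>" and "u \<in> borel_measurable M" and "j \<in> borel_measurable M"
    and "\<And>A. A \<in> sets M \<Longrightarrow> (\<integral>\<^sup>+x\<in>A. j x \<partial>M) =
      (\<integral>\<^sup>+x\<in>(\<phi> ^^ n) -` A \<inter> space M. ennreal (\<bar>weight u \<phi> n x\<bar>\<^sup>2) \<partial>M)"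
  shows "AE x in M. wco_J M u \<phi> n x = j x"
proof -
  have J: "wco_J M u \<phi> n \<in> borel_measurable M"
    by (simp add: wco_J_def)
  have "density M j = density M (wco_J M u \<phi> n)"
  proof (rule measure_eqI)
    fix A assume "A \<in> sets (density M j)"
    then have A: "A \<in> sets M" by simp
    show "emeasure (density M j) A = emeasure (density M (wco_J M u \<phi> n)) A"
      using A assms(3) J by (simp add: emeasure_density assms(4)
          set_nn_integral_wco_J[OF assms(1,2)])
  qed simp
  then have "AE x in M. j x = wco_J M u \<phi> n x"
    using assms(3) by (subst (asm) density_unique_iff) (auto simp: wco_J_def)
  then show ?thesis
    by auto
qed

lemma wco_J_eq_h_E:
  assumes ns: "nonsingular M \<phi>" and u: "u \<in> borel_measurable M"
    and sf: "sigma_finite_subalgebra M (vimage_algebra (space M) (\<phi> ^^ n) M)"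
    and g [measurable]: "g \<in> borel_measurable M"
    and E: "AE x in M. cond_E M \<phi> n (\<lambda>x. ennreal (\<bar>weight u \<phi> n x\<bar>\<^sup>2)) x = g ((\<phi> ^^ n) x)"
  shows "AE x in M. wco_J M u \<phi> n x = rn_h M \<phi> n x * g x"
proof (rule wco_J_unique[OF ns u])
  interpret F: sigma_finite_subalgebra M "vimage_algebra (space M) (\<phi> ^^ n) M"
    by (rule sf)
  have w [measurable]: "weight u \<phi> n \<in> borel_measurable M"
    by (rule borel_measurable_weight[OF ns u])
  have p [measurable]: "\<phi> ^^ n \<in> measurable M M"
    and ac: "absolutely_continuous M (distr M M (\<phi> ^^ n))"
    using nonsingular_funpow[OF ns] by (auto simp: nonsingular_def)
  show "(\<lambda>x. rn_h M \<phi> n x * g x) \<in> borel_measurable M"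
    unfolding rn_h_def by measurable
  fix A assume A [measurable]: "A \<in> sets M"
  have B: "(\<phi> ^^ n) -` A \<inter> space M \<in> sets (vimage_algebra (space M) (\<phi> ^^ n) M)"
    using A by (rule in_vimage_algebra)
  have "(\<integral>\<^sup>+x\<in>A. rn_h M \<phi> n x * g x \<partial>M) = (\<integral>\<^sup>+x. rn_h M \<phi> n x * (g x * indicator A x) \<partial>M)"
    by (simp add: mult.assoc)
  also have "\<dots> = (\<integral>\<^sup>+x. g x * indicator A x \<partial>distr M M (\<phi> ^^ n))"
    unfolding rn_h_def by (rule RN_deriv_nn_integral[OF ac, symmetric]) auto
  also have "\<dots> = (\<integral>\<^sup>+x. g ((\<phi> ^^ n) x) * indicator A ((\<phi> ^^ n) x) \<partial>M)"
    by (rule nn_integral_distr) auto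
  also have "\<dots> = (\<integral>\<^sup>+x. indicator ((\<phi> ^^ n) -` A \<inter> space M) x *
      cond_E M \<phi> n (\<lambda>x. ennreal (\<bar>weight u \<phi> n x\<bar>\<^sup>2)) x \<partial>M)"
    by (rule nn_integral_cong_AE) (use E in \<open>auto elim!: AE_mp simp: indicator_def\<close>)
  also have "\<dots> = (\<integral>\<^sup>+x. indicator ((\<phi> ^^ n) -` A \<inter> space M) x *
      ennreal (\<bar>weight u \<phi> n x\<bar>\<^sup>2) \<partial>M)"
    unfolding cond_E_def by (rule F.nn_cond_exp_intg) (use B in auto)
  finally show "(\<integral>\<^sup>+x\<in>A. rn_h M \<phi> n x * g x \<partial>M) =
      (\<integral>\<^sup>+x\<in>(\<phi> ^^ n) -` A \<inter> space M. ennreal (\<bar>weight u \<phi> n x\<bar>\<^sup>2) \<partial>M)"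
    by (simp add: mult.commute)
qed

end

lemma sq_integrable_mult:
  assumes f: "f \<in> sq_integrable M" and g: "g \<in> sq_integrable M"
  shows "integrable M (\<lambda>x. f x * g x)"
proof (rule Bochner_Integration.integrable_bound)
  show "integrable M (\<lambda>x. (cmod (f x))\<^sup>2 + (cmod (g x))\<^sup>2)"
    using f g by (auto simp: sq_integrable_def)
  show "(\<lambda>x. f x * g x) \<in> borel_measurable M"
    using f g by (auto simp: sq_integrable_def)
  have "a * b \<le> a\<^sup>2 + b\<^sup>2" if "0 \<le> a" "0 \<le> b" for a b :: real
    using sum_squares_bound[of a b] that mult_nonneg_nonneg[OF that] by linarith
  then show "AE x in M. norm (f x * g x) \<le> norm ((cmod (f x))\<^sup>2 + (cmod (g x))\<^sup>2)"
    by (simp add: norm_mult)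
qed

lemma sq_integrable_diff:
  assumes f: "f \<in> sq_integrable M" and g: "g \<in> sq_integrable M"
  shows "(\<lambda>x. f x - g x) \<in> sq_integrable M"
proof -
  have m: "f \<in> borel_measurable M" "g \<in> borel_measurable M"
    using f g by (auto simp: sq_integrable_def)
  have "integrable M (\<lambda>x. (cmod (f x - g x))\<^sup>2)"
  proof (rule Bochner_Integration.integrable_bound)
    show "integrable M (\<lambda>x. 2 * (cmod (f x))\<^sup>2 + 2 * (cmod (g x))\<^sup>2)"
      using f g by (auto simp: sq_integrable_def)
    have "(cmod (a - b))\<^sup>2 \<le> 2 * (cmod a)\<^sup>2 + 2 * (cmod b)\<^sup>2" for a b
    proof -
      have "(cmod (a - b))\<^sup>2 \<le> (cmod a + cmod b)\<^sup>2"
        by (intro power_mono norm_triangle_ineq4) auto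
      then show ?thesis
        using sum_squares_bound[of "cmod a" "cmod b"] by (simp add: power2_sum)
    qed
    then show "AE x in M. norm ((cmod (f x - g x))\<^sup>2) \<le>
        norm (2 * (cmod (f x))\<^sup>2 + 2 * (cmod (g x))\<^sup>2)"
      by simp
  qed (use m in auto)
  then show ?thesis
    using m by (simp add: sq_integrable_def)
qed

lemma Minkowski_sq_integrable:
  assumes f: "f \<in> sq_integrable M" and g: "g \<in> sq_integrable M"
  shows "sqrt (\<integral>x. (cmod (f x + g x))\<^sup>2 \<partial>M) \<le>
    sqrt (\<integral>x. (cmod (f x))\<^sup>2 \<partial>M) + sqrt (\<integral>x. (cmod (g x))\<^sup>2 \<partial>M)"
proof -
  define a b c where "a = (\<integral>x. (cmod (f x))\<^sup>2 \<partial>M)" and "b = (\<integral>x. (cmod (g x))\<^sup>2 \<partial>M)"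
    and "c = (\<integral>x. cmod (f x) * cmod (g x) \<partial>M)"
  have m [measurable]: "f \<in> borel_measurable M" "g \<in> borel_measurable M"
    and i: "integrable M (\<lambda>x. (cmod (f x))\<^sup>2)" "integrable M (\<lambda>x. (cmod (g x))\<^sup>2)"
    using f g by (auto simp: sq_integrable_def)
  have ifg: "integrable M (\<lambda>x. cmod (f x) * cmod (g x))"
    using integrable_norm[OF sq_integrable_mult[OF f g]] by (simp add: norm_mult)
  have nn: "0 \<le> a" "0 \<le> b" "0 \<le> c"
    by (auto simp: a_def b_def c_def)
  have "(\<integral>\<^sup>+x. ennreal (cmod (f x)) * ennreal (cmod (g x)) \<partial>M)\<^sup>2 \<le>
      (\<integral>\<^sup>+x. (ennreal (cmod (f x)))\<^sup>2 \<partial>M) * (\<integral>\<^sup>+x. (ennreal (cmod (g x)))\<^sup>2 \<partial>M)"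
    by (rule Cauchy_Schwarz_nn_integral) auto
  then have "(ennreal c)\<^sup>2 \<le> ennreal a * ennreal b"
    using i ifg by (simp add: a_def b_def c_def nn_integral_eq_integral ennreal_power
        ennreal_mult''[symmetric])
  then have "c\<^sup>2 \<le> a * b"
    using nn by (simp add: ennreal_power ennreal_mult''[symmetric])
  then have c: "c \<le> sqrt a * sqrt b"
    using real_le_rsqrt by (simp add: real_sqrt_mult[symmetric])
  have "(\<integral>x. (cmod (f x + g x))\<^sup>2 \<partial>M) \<le>
      (\<integral>x. (cmod (f x))\<^sup>2 + (cmod (g x))\<^sup>2 + 2 * (cmod (f x) * cmod (g x)) \<partial>M)"
  proof (rule integral_mono')
    fix x
    have "(cmod (f x + g x))\<^sup>2 \<le> (cmod (f x) + cmod (g x))\<^sup>2"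
      by (intro power_mono norm_triangle_ineq) auto
    then show "(cmod (f x + g x))\<^sup>2 \<le>
        (cmod (f x))\<^sup>2 + (cmod (g x))\<^sup>2 + 2 * (cmod (f x) * cmod (g x))"
      by (simp add: power2_sum)
  qed (use i ifg in auto)
  also have "\<dots> = a + b + 2 * c"
    using i ifg by (simp add: a_def b_def c_def)
  also have "\<dots> \<le> (sqrt a + sqrt b)\<^sup>2"
    using c nn by (simp add: power2_sum)
  finally show ?thesis
    using nn unfolding a_def[symmetric] b_def[symmetric]
    by (intro real_le_lsqrt) auto
qed

lemma Metric_space_L2: "Metric_space (L2 M) (l2_dist M)"
proof
  fix F G
  show "0 \<le> l2_dist M F G" and "l2_dist M F G = l2_dist M G F"
    by (auto simp: l2_dist_def norm_minus_commute)
  assume F: "F \<in> L2 M" and G: "G \<in> L2 M"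
  have d: "(\<lambda>x. rep F x - rep G x) \<in> sq_integrable M"
    by (intro sq_integrable_diff rep_L2 F G)
  show "l2_dist M F G = 0 \<longleftrightarrow> F = G"
  proof
    assume "l2_dist M F G = 0"
    then have "(\<integral>x. (cmod (rep F x - rep G x))\<^sup>2 \<partial>M) = 0"
      by (simp add: l2_dist_def)
    then have "AE x in M. rep F x = rep G x"
      using d by (subst (asm) integral_nonneg_eq_0_iff_AE) (auto simp: sq_integrable_def)
    then have "ae_class M (rep F) = ae_class M (rep G)"
      by (rule ae_class_cong)
    then show "F = G"
      by (simp add: rep_L2 F G)
  qed (simp add: l2_dist_def)
  fix H assume H: "H \<in> L2 M"
  have "(\<lambda>x. rep G x - rep H x) \<in> sq_integrable M"
    by (intro sq_integrable_diff rep_L2 G H)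
  from Minkowski_sq_integrable[OF d this]
  show "l2_dist M F H \<le> l2_dist M F G + l2_dist M G H"
    by (simp add: l2_dist_def)
qed

end

theory Submission
  imports Defs
begin

text \<open>Everything rests on the change of variables formula
  \<open>\<integral> (g \<circ> \<phi>\<^sup>n) |u\<^sub>n|\<^sup>2 d\<mu> = \<integral> g J\<^sub>n d\<mu>\<close>; for \<open>n = 1\<close> it says \<open>\<parallel>W f\<parallel>\<^sup>2 = \<integral> |f|\<^sup>2 J d\<mu>\<close>.

  \<^emph>\<open>Lower bound for \<open>J\<close>.\<close> Suppose that \<open>W\<close> has closed range and \<open>\<integral> |f|\<^sup>2 J d\<mu> < \<infinity>\<close>. The truncations
  of \<open>f\<close> to \<open>{J \<ge> 1/n}\<close> lie in \<open>L\<^sup>2\<close> and their images converge to \<open>u \<cdot> (f \<circ> \<phi>)\<close>, which therefore is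
  \<open>W k\<close> for some \<open>k\<close> in \<open>L\<^sup>2\<close>; as \<open>f = k\<close> a.e. on \<open>S(J)\<close>, \<open>f\<close> is square integrable on \<open>S(J)\<close>
  (\<open>closed_range_imp_integrable\<close>). If \<open>J\<close> were not bounded away from \<open>0\<close> on \<open>S(J)\<close>, taking
  for \<open>|f|\<^sup>2\<close> a sum of functions of unit mass, the \<open>k\<close>-th one supported in \<open>{0 < J < 2\<^sup>-\<^sup>k}\<close>, would contradict this
  (\<open>closed_range_imp_J_bounded_below\<close>). So \<open>J \<ge> \<delta>\<close> a.e. on \<open>S(J)\<close>.

  \<^emph>\<open>Lower bound for \<open>J\<^sub>n\<close>.\<close> Since \<open>u\<^sub>n\<^sub>+\<^sub>1 = (u\<^sub>n \<circ> \<phi>) \<cdot> u\<close>, one has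
  \<open>\<integral> g J\<^sub>n\<^sub>+\<^sub>1 d\<mu> = \<integral> (g \<circ> \<phi>\<^sup>n) |u\<^sub>n|\<^sup>2 J d\<mu>\<close>. For \<open>g\<close> supported in \<open>S(J)\<close>, invariance makes
  \<open>g \<circ> \<phi>\<^sup>n\<close> supported in \<open>S(J)\<close>, so the right-hand side is at least
  \<open>\<delta> \<integral> (g \<circ> \<phi>\<^sup>n) |u\<^sub>n|\<^sup>2 d\<mu> = \<delta> \<integral> g J\<^sub>n d\<mu>\<close>, and induction gives \<open>J\<^sub>n \<ge> \<delta>\<^sup>n\<close> on \<open>S(J)\<close>.

  \<^emph>\<open>Closed ranges.\<close> If \<open>S(J) = X\<close>, then \<open>W\<close> is bounded below. A convergent sequence in the image of a
  closed set \<open>A\<close> has its limit in the range of \<open>W\<close>, and by the lower bound the preimages converge, so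
  \<open>W\<close> maps closed sets to closed sets; hence all powers have closed range. For the adjoint,
  \<open>W\<^sup>* W\<close> is multiplication by \<open>J\<close>, so that \<open>W\<^sup>*(W (h / J)) = h\<close>: the adjoint and its powers are onto.
  That the adjoint exists is shown by exhibiting \<open>W\<^sup>* g\<close>, for \<open>g \<ge> 0\<close>, as the Radon-Nikodym
  derivative of the image under \<open>\<phi>\<close> of the measure with density \<open>u g\<close> (\<open>adjoint_pair_nonneg\<close>). Neither
  completeness of \<open>L\<^sup>2\<close> nor the Riesz representation theorem is needed.\<close>

section \<open>Square-integrable functions and their classes\<close>

text \<open>The squared \<open>L\<^sup>2\<close> norm of a function, as an extended nonnegative real, so that it is
  meaningful also for functions that are not square integrable.\<close>

definition l2_sq :: "'a measure \<Rightarrow> ('a \<Rightarrow> complex) \<Rightarrow> ennreal" where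
  "l2_sq M f = (\<integral>\<^sup>+x. ennreal ((cmod (f x))\<^sup>2) \<partial>M)"

lemma sq_integrable_iff_l2_sq:
  "f \<in> sq_integrable M \<longleftrightarrow> f \<in> borel_measurable M \<and> l2_sq M f < \<infinity>"
  by (auto simp: sq_integrable_def l2_sq_def integrable_iff_bounded)

lemma l2_sq_eq_integral:
  "f \<in> sq_integrable M \<Longrightarrow> l2_sq M f = ennreal (\<integral>x. (cmod (f x))\<^sup>2 \<partial>M)"
  unfolding l2_sq_def by (rule nn_integral_eq_integral) (auto simp: sq_integrable_def)

lemma sq_integrable_add:
  assumes "f \<in> sq_integrable M" and "g \<in> sq_integrable M"
  shows "(\<lambda>x. f x + g x) \<in> sq_integrable M"
proof -
  have "(\<lambda>x. - g x) \<in> sq_integrable M"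
    using assms(2) by (auto simp: sq_integrable_def)
  from sq_integrable_diff[OF assms(1) this] show ?thesis
    by simp
qed

lemma sq_integrable_cmult:
  assumes "f \<in> sq_integrable M"
  shows "(\<lambda>x. c * f x) \<in> sq_integrable M"
  using assms by (auto simp: sq_integrable_def norm_mult power_mult_distrib)

lemma sq_integrable_bound:
  assumes "f \<in> sq_integrable M" and [measurable]: "g \<in> borel_measurable M"
    and le: "\<And>x. cmod (g x) \<le> cmod (f x)"
  shows "g \<in> sq_integrable M"
proof -
  have "l2_sq M g \<le> l2_sq M f"
    unfolding l2_sq_def by (intro nn_integral_mono ennreal_leI power_mono le) auto
  then show ?thesis
    using assms by (auto simp: sq_integrable_iff_l2_sq)
qed

lemma ae_class_in_L2: "f \<in> sq_integrable M \<Longrightarrow> ae_class M f \<in> L2 M"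
  by (simp add: L2_def)

lemma L2_cases:
  assumes "F \<in> L2 M"
  obtains f where "f \<in> sq_integrable M" and "F = ae_class M f"
  using assms by (auto simp: L2_def)

lemma ae_class_eq_iff:
  assumes "f \<in> borel_measurable M" and "g \<in> borel_measurable M"
  shows "ae_class M f = ae_class M g \<longleftrightarrow> (AE x in M. f x = g x)"
proof
  assume "ae_class M f = ae_class M g"
  moreover have "f \<in> ae_class M f"
    using assms by (simp add: ae_class_def)
  ultimately show "AE x in M. f x = g x"
    by (simp add: ae_class_def)
qed (rule ae_class_cong)

lemma l2_dist_ae_class:
  assumes f: "f \<in> sq_integrable M" and g: "g \<in> sq_integrable M"
  shows "ennreal ((l2_dist M (ae_class M f) (ae_class M g))\<^sup>2) = l2_sq M (\<lambda>x. f x - g x)"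
proof -
  have [measurable]: "f \<in> borel_measurable M" "g \<in> borel_measurable M"
    using f g by (auto simp: sq_integrable_def)
  note [measurable] = rep_ae_class(1)[of f M] rep_ae_class(1)[of g M]
  have "(\<integral>x. (cmod (rep (ae_class M f) x - rep (ae_class M g) x))\<^sup>2 \<partial>M) = (\<integral>x. (cmod (f x - g x))\<^sup>2 \<partial>M)"
    by (rule integral_cong_AE) (use rep_ae_class(2)[of f M] rep_ae_class(2)[of g M] in auto)
  then show ?thesis
    using sq_integrable_diff[OF f g] by (simp add: l2_dist_def l2_sq_eq_integral)
qed

lemma l2_norm_ae_class:
  assumes f: "f \<in> sq_integrable M"
  shows "ennreal ((l2_norm M (ae_class M f))\<^sup>2) = l2_sq M f"
proof -
  have [measurable]: "f \<in> borel_measurable M"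
    using f by (auto simp: sq_integrable_def)
  note [measurable] = rep_ae_class(1)[of f M]
  have "(\<integral>x. (cmod (rep (ae_class M f) x))\<^sup>2 \<partial>M) = (\<integral>x. (cmod (f x))\<^sup>2 \<partial>M)"
    by (rule integral_cong_AE) (use rep_ae_class(2)[of f M] in auto)
  then show ?thesis
    using f by (simp add: l2_norm_def l2_sq_eq_integral)
qed

lemma borel_measurable_cnj [measurable]:
  "f \<in> borel_measurable M \<Longrightarrow> (\<lambda>x. cnj (f x)) \<in> borel_measurable M"
  by (rule borel_measurable_continuous_on[OF continuous_on_cnj[OF continuous_on_id]])

lemma sq_integrable_cnj: "f \<in> sq_integrable M \<Longrightarrow> (\<lambda>x. cnj (f x)) \<in> sq_integrable M"
  by (auto simp: sq_integrable_def)

lemma l2_inner_ae_class: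
  assumes [measurable]: "f \<in> borel_measurable M" "g \<in> borel_measurable M"
  shows "l2_inner M (ae_class M f) (ae_class M g) = (\<integral>x. f x * cnj (g x) \<partial>M)"
proof -
  note [measurable] = rep_ae_class(1)[OF assms(1)] rep_ae_class(1)[OF assms(2)]
  show ?thesis
    unfolding l2_inner_def
    by (rule integral_cong_AE) (use rep_ae_class(2)[OF assms(1)] rep_ae_class(2)[OF assms(2)] in auto)
qed

text \<open>A class is determined by its inner products; this gives uniqueness of the adjoint.\<close>

lemma l2_inner_eqD:
  assumes H: "H \<in> L2 M" "H' \<in> L2 M"
    and eq: "\<And>F. F \<in> L2 M \<Longrightarrow> l2_inner M F H = l2_inner M F H'"
  shows "H = H'"
proof -
  obtain h where h: "h \<in> sq_integrable M" "H = ae_class M h"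
    using H(1) by (rule L2_cases)
  obtain h' where h': "h' \<in> sq_integrable M" "H' = ae_class M h'"
    using H(2) by (rule L2_cases)
  have [measurable]: "h \<in> borel_measurable M" "h' \<in> borel_measurable M"
    using h h' by (auto simp: sq_integrable_def)
  define d where "d x = h x - h' x" for x
  have d: "d \<in> sq_integrable M"
    unfolding d_def[abs_def] by (rule sq_integrable_diff[OF h(1) h'(1)])
  have [measurable]: "d \<in> borel_measurable M"
    using d by (simp add: sq_integrable_def)
  have i: "integrable M (\<lambda>x. (cmod (d x))\<^sup>2)"
    using d by (simp add: sq_integrable_def)
  have "(\<integral>x. d x * cnj (h x) \<partial>M) = (\<integral>x. d x * cnj (h' x) \<partial>M)"
    using eq[OF ae_class_in_L2[OF d]] by (simp add: h h' l2_inner_ae_class)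
  then have "0 = (\<integral>x. d x * cnj (h x) - d x * cnj (h' x) \<partial>M)"
    using sq_integrable_mult[OF d sq_integrable_cnj[OF h(1)]] sq_integrable_mult[OF d sq_integrable_cnj[OF h'(1)]] by simp
  also have "\<dots> = (\<integral>x. complex_of_real ((cmod (d x))\<^sup>2) \<partial>M)"
    unfolding complex_norm_square by (simp only: d_def complex_cnj_diff right_diff_distrib)
  also have "\<dots> = complex_of_real (\<integral>x. (cmod (d x))\<^sup>2 \<partial>M)"
    by (rule integral_complex_of_real)
  finally have "(\<integral>x. (cmod (d x))\<^sup>2 \<partial>M) = 0"
    by simp
  then have "AE x in M. h x = h' x"
    using i by (subst (asm) integral_nonneg_eq_0_iff_AE) (auto simp: d_def)
  then show ?thesis
    unfolding h h' by (rule ae_class_cong)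
qed

lemma closedin_L2_iff:
  "closedin (Metric_space.mtopology (L2 M) (l2_dist M)) S \<longleftrightarrow>
    S \<subseteq> L2 M \<and> (\<forall>\<sigma> l. range \<sigma> \<subseteq> S \<longrightarrow> l \<in> L2 M \<longrightarrow> (\<lambda>n. l2_dist M (\<sigma> n) l) \<longlonglongrightarrow> 0 \<longrightarrow> l \<in> S)"
proof -
  interpret Metric_space "L2 M" "l2_dist M"
    by (rule Metric_space_L2)
  have lim: "limitin mtopology \<sigma> l sequentially \<longleftrightarrow> l \<in> L2 M \<and> (\<lambda>n. l2_dist M (\<sigma> n) l) \<longlonglongrightarrow> 0"
    if "range \<sigma> \<subseteq> L2 M" for \<sigma> l
    using that unfolding limitin_metric_dist_null by (auto intro!: always_eventually)
  show ?thesis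
    unfolding metric_closedin_iff_sequentially_closed
  proof (intro conj_cong refl iff_allI)
    fix \<sigma> :: "nat \<Rightarrow> ('a \<Rightarrow> complex) set" and l
    assume "S \<subseteq> L2 M"
    then have "range \<sigma> \<subseteq> S \<Longrightarrow> range \<sigma> \<subseteq> L2 M"
      by (rule subset_trans[rotated])
    then show "(range \<sigma> \<subseteq> S \<and> limitin mtopology \<sigma> l sequentially \<longrightarrow> l \<in> S) =
        (range \<sigma> \<subseteq> S \<longrightarrow> l \<in> L2 M \<longrightarrow> (\<lambda>n. l2_dist M (\<sigma> n) l) \<longlonglongrightarrow> 0 \<longrightarrow> l \<in> S)"
      using lim[of \<sigma> l] by metis
  qed
qed

lemma l2_dist_tendsto_0I:
  assumes "\<And>n. f n \<in> sq_integrable M" and "g \<in> sq_integrable M"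
    and "(\<lambda>n. l2_sq M (\<lambda>x. f n x - g x)) \<longlonglongrightarrow> 0"
  shows "(\<lambda>n. l2_dist M (ae_class M (f n)) (ae_class M g)) \<longlonglongrightarrow> 0"
proof -
  have "(\<lambda>n. ennreal ((l2_dist M (ae_class M (f n)) (ae_class M g))\<^sup>2)) \<longlonglongrightarrow> ennreal 0"
    using assms by (simp add: l2_dist_ae_class)
  then have "(\<lambda>n. (l2_dist M (ae_class M (f n)) (ae_class M g))\<^sup>2) \<longlonglongrightarrow> 0"
    by (subst (asm) tendsto_ennreal_iff) auto
  from tendsto_real_sqrt[OF this] show ?thesis
    by (simp add: l2_dist_def)
qed

section \<open>The change of variables formula\<close>

text \<open>The data of a weighted composition operator. Boundedness of the operator is a separate hypothesis
  of the lemmas that need it.\<close>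

locale weighted_composition = sigma_finite_measure M for M :: "'a measure" +
  fixes u :: "'a \<Rightarrow> real" and \<phi> :: "'a \<Rightarrow> 'a"
  assumes nonsingular: "nonsingular M \<phi>"
    and measurable_u [measurable]: "u \<in> borel_measurable M"
begin

text \<open>The function \<open>J = J\<^sub>1\<close>.\<close>

definition J :: "'a \<Rightarrow> ennreal" where
  "J = wco_J M u \<phi> 1"

text \<open>The operator \<open>f \<mapsto> u \<cdot> (f \<circ> \<phi>)\<close> on functions rather than on classes.\<close>

definition wc :: "('a \<Rightarrow> complex) \<Rightarrow> 'a \<Rightarrow> complex" where
  "wc f x = complex_of_real (u x) * f (\<phi> x)"

lemma measurable_funpow_phi [measurable]: "\<phi> ^^ n \<in> measurable M M"
  using nonsingular_funpow[OF nonsingular] by (simp add: nonsingular_def)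

lemma measurable_phi [measurable]: "\<phi> \<in> measurable M M"
  using nonsingular by (simp add: nonsingular_def)

lemma measurable_weight [measurable]: "weight u \<phi> n \<in> borel_measurable M"
  by (rule borel_measurable_weight[OF nonsingular measurable_u])

lemma measurable_wco_J [measurable]: "wco_J M u \<phi> n \<in> borel_measurable M"
  by (simp add: wco_J_def)

lemma measurable_J [measurable]: "J \<in> borel_measurable M"
  by (simp add: J_def)

lemma sets_supp_J [measurable]: "supp M J \<in> sets M"
proof -
  have "supp M J = J -` (- {0}) \<inter> space M"
    by (auto simp: supp_def)
  also have "\<dots> \<in> sets M"
    by (rule measurable_sets[OF measurable_J]) auto
  finally show ?thesis .
qed

lemma measurable_wc [measurable]: "f \<in> borel_measurable M \<Longrightarrow> wc f \<in> borel_measurable M"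
  unfolding wc_def[abs_def] by (measurable, rule measurable_compose[OF measurable_phi])

lemma nn_integral_wco_J:
  assumes [measurable]: "g \<in> borel_measurable M"
  shows "(\<integral>\<^sup>+x. g x * wco_J M u \<phi> n x \<partial>M) =
    (\<integral>\<^sup>+x. g ((\<phi> ^^ n) x) * ennreal ((weight u \<phi> n x)\<^sup>2) \<partial>M)"
proof -
  have "(\<integral>\<^sup>+x. g x * wco_J M u \<phi> n x \<partial>M) = (\<integral>\<^sup>+x. g x \<partial>density M (wco_J M u \<phi> n))"
    by (subst nn_integral_density) (auto simp: mult.commute)
  also have "\<dots> = (\<integral>\<^sup>+x. g ((\<phi> ^^ n) x) * ennreal ((weight u \<phi> n x)\<^sup>2) \<partial>M)"
    unfolding density_wco_J[OF nonsingular measurable_u]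
    by (subst nn_integral_distr) (auto simp: nn_integral_density mult.commute)
  finally show ?thesis .
qed

lemma nn_integral_J:
  assumes "g \<in> borel_measurable M"
  shows "(\<integral>\<^sup>+x. g x * J x \<partial>M) = (\<integral>\<^sup>+x. g (\<phi> x) * ennreal ((u x)\<^sup>2) \<partial>M)"
  using nn_integral_wco_J[OF assms, of 1] by (simp add: weight_def J_def)

lemma l2_sq_wc:
  assumes [measurable]: "f \<in> borel_measurable M"
  shows "l2_sq M (wc f) = (\<integral>\<^sup>+x. ennreal ((cmod (f x))\<^sup>2) * J x \<partial>M)"
proof -
  have "ennreal ((cmod (wc f x))\<^sup>2) = ennreal ((cmod (f (\<phi> x)))\<^sup>2) * ennreal ((u x)\<^sup>2)" for x
    by (simp add: wc_def norm_mult power_mult_distrib ennreal_mult mult.commute)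
  then show ?thesis
    unfolding l2_sq_def by (subst nn_integral_J) simp_all
qed

lemma wco_ae_class_eq: "f \<in> borel_measurable M \<Longrightarrow> wco M u \<phi> (ae_class M f) = ae_class M (wc f)"
  unfolding wc_def[abs_def] by (rule wco_ae_class[OF nonsingular])

lemma wc_diff: "wc (\<lambda>x. f x - g x) = (\<lambda>x. wc f x - wc g x)"
  by (auto simp: wc_def algebra_simps)

lemma wco_J_0: "AE x in M. wco_J M u \<phi> 0 x = 1"
proof (rule wco_J_unique[OF nonsingular measurable_u])
  fix A
  show "(\<integral>\<^sup>+x\<in>A. 1 \<partial>M) =
      (\<integral>\<^sup>+x\<in>(\<phi> ^^ 0) -` A \<inter> space M. ennreal (\<bar>weight u \<phi> 0 x\<bar>\<^sup>2) \<partial>M)"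
    by (rule nn_integral_cong) (simp add: weight_def indicator_def)
qed simp

lemma nn_integral_wco_J_Suc:
  assumes [measurable]: "g \<in> borel_measurable M"
  shows "(\<integral>\<^sup>+x. g x * wco_J M u \<phi> (Suc n) x \<partial>M) =
    (\<integral>\<^sup>+x. g ((\<phi> ^^ n) x) * ennreal ((weight u \<phi> n x)\<^sup>2) * J x \<partial>M)"
proof -
  have w: "weight u \<phi> (Suc n) x = weight u \<phi> n (\<phi> x) * u x" for x
    unfolding weight_def by (subst prod.lessThan_Suc_shift) (simp add: funpow_swap1)
  have "(\<integral>\<^sup>+x. g x * wco_J M u \<phi> (Suc n) x \<partial>M) =
      (\<integral>\<^sup>+x. g ((\<phi> ^^ n) (\<phi> x)) * ennreal ((weight u \<phi> n (\<phi> x))\<^sup>2) * ennreal ((u x)\<^sup>2) \<partial>M)"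
    unfolding nn_integral_wco_J[OF assms] w funpow_Suc_right o_apply
    by (simp add: power_mult_distrib ennreal_mult mult.assoc)
  also have "\<dots> = (\<integral>\<^sup>+x. g ((\<phi> ^^ n) x) * ennreal ((weight u \<phi> n x)\<^sup>2) * J x \<partial>M)"
    by (rule nn_integral_J[symmetric]) measurable
  finally show ?thesis .
qed

section \<open>A positive lower bound on the Radon-Nikodym derivatives\<close>

text \<open>In terms of \<open>f = sqrt g\<close>: if \<open>u \<cdot> (f \<circ> \<phi>)\<close> is square integrable, then \<open>f\<close> is square integrable on
  \<open>S(J)\<close>, because \<open>u \<cdot> (f \<circ> \<phi>)\<close> is a limit of images of truncations of \<open>f\<close>.\<close>

lemma closed_range_imp_integrable:
  assumes closed: "has_closed_range M (wco M u \<phi>)"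
    and [measurable]: "g \<in> borel_measurable M"
    and fin: "(\<integral>\<^sup>+x. g x * J x \<partial>M) < \<infinity>"
  shows "(\<integral>\<^sup>+x. g x * indicator (supp M J) x \<partial>M) < \<infinity>"
proof -
  define f where "f x = complex_of_real (sqrt (enn2real (g x)))" for x
  define A where "A n = {x \<in> space M. ennreal (inverse (Suc n)) \<le> J x}" for n
  define fn where "fn n x = f x * indicator (A n) x" for n x
  have [measurable]: "f \<in> borel_measurable M"
    unfolding f_def[abs_def] by measurable
  have [measurable]: "A n \<in> sets M" for n
    unfolding A_def by measurable
  have [measurable]: "fn n \<in> borel_measurable M" for n
    unfolding fn_def[abs_def] by measurable
  \<comment> \<open>Where \<open>g = \<infinity>\<close> the square of \<open>f\<close> is not \<open>g\<close>, since \<open>enn2real \<infinity> = 0\<close>; this set meets \<open>S(J)\<close> in a null set.\<close>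
  have fsq: "ennreal ((cmod (f x))\<^sup>2) = (if g x = \<infinity> then 0 else g x)" for x
    by (cases "g x") (auto simp: f_def)
  have wf: "wc f \<in> sq_integrable M"
  proof -
    have "l2_sq M (wc f) \<le> (\<integral>\<^sup>+x. g x * J x \<partial>M)"
      unfolding l2_sq_wc[OF \<open>f \<in> borel_measurable M\<close>]
      by (intro nn_integral_mono mult_right_mono) (auto simp: fsq)
    then show ?thesis
      using fin by (auto simp: sq_integrable_iff_l2_sq)
  qed
  have fn: "fn n \<in> sq_integrable M" for n
  proof -
    have "1 \<le> ennreal (Suc n) * J x" if "x \<in> A n" for x
    proof -
      have "1 = ennreal (Suc n) * ennreal (inverse (Suc n))"
        by (simp add: ennreal_mult[symmetric] del: of_nat_Suc)
      also have "\<dots> \<le> ennreal (Suc n) * J x"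
        using that by (intro mult_left_mono) (auto simp: A_def)
      finally show ?thesis .
    qed
    then have "ennreal ((cmod (fn n x))\<^sup>2) \<le> ennreal (Suc n) * (ennreal ((cmod (f x))\<^sup>2) * J x)" for x
      using mult_left_mono[of 1 "ennreal (Suc n) * J x" "ennreal ((cmod (f x))\<^sup>2)"]
      by (auto simp: fn_def indicator_def mult_ac)
    then have "l2_sq M (fn n) \<le> (\<integral>\<^sup>+x. ennreal (Suc n) * (ennreal ((cmod (f x))\<^sup>2) * J x) \<partial>M)"
      unfolding l2_sq_def by (intro nn_integral_mono)
    also have "\<dots> = ennreal (Suc n) * l2_sq M (wc f)"
      by (simp add: l2_sq_wc nn_integral_cmult del: of_nat_Suc)
    also have "\<dots> < \<infinity>"
      using wf by (auto simp: sq_integrable_iff_l2_sq ennreal_mult_less_top simp del: of_nat_Suc)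
    finally show ?thesis
      by (auto simp: sq_integrable_iff_l2_sq)
  qed
  have W: "wco M u \<phi> (ae_class M (fn n)) = ae_class M (wc (fn n))" for n
    by (simp add: wco_ae_class_eq)
  have range: "wco M u \<phi> ` L2 M \<subseteq> L2 M"
    using closed by (auto simp: has_closed_range_def closedin_L2_iff)
  have wfn: "wc (fn n) \<in> sq_integrable M" for n
    by (rule sq_integrable_bound[OF wf])
       (auto simp: fn_def wc_def norm_mult indicator_def)
  have "(\<lambda>n. l2_sq M (\<lambda>x. wc (fn n) x - wc f x)) \<longlonglongrightarrow> 0"
  proof -
    let ?r = "\<lambda>n x. ennreal ((cmod (f x))\<^sup>2) * J x * indicator (- A n) x"
    have eq: "l2_sq M (\<lambda>x. wc (fn n) x - wc f x) = (\<integral>\<^sup>+x. ?r n x \<partial>M)" for n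
      unfolding wc_diff[symmetric]
      by (subst l2_sq_wc) (auto simp: fn_def indicator_def norm_mult mult_ac intro!: nn_integral_cong)
    have "(\<lambda>n. \<integral>\<^sup>+x. ?r n x \<partial>M) \<longlonglongrightarrow> (\<integral>\<^sup>+x. 0 \<partial>M)"
    proof (rule nn_integral_dominated_convergence[where w="\<lambda>x. ennreal ((cmod (f x))\<^sup>2) * J x"])
      show "(\<integral>\<^sup>+x. ennreal ((cmod (f x))\<^sup>2) * J x \<partial>M) < \<infinity>"
        using wf by (simp add: sq_integrable_iff_l2_sq l2_sq_wc)
      have "eventually (\<lambda>n. ?r n x = 0) sequentially" if x: "x \<in> space M" for x
      proof (cases "J x = 0")
        case False
        have "(\<lambda>n. ennreal (inverse (real (Suc n)))) \<longlonglongrightarrow> ennreal 0"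
          by (intro tendsto_ennrealI LIMSEQ_inverse_real_of_nat)
        then have "eventually (\<lambda>n. ennreal (inverse (real (Suc n))) < J x) sequentially"
          using False by (intro order_tendstoD(2)) (auto simp: zero_less_iff_neq_zero)
        then show ?thesis
          by eventually_elim (use x in \<open>auto simp: A_def indicator_def intro: less_imp_le\<close>)
      qed auto
      then show "AE x in M. (\<lambda>n. ?r n x) \<longlonglongrightarrow> 0"
        by (intro AE_I2 tendsto_eventually)
    qed (auto simp: indicator_def)
    then show ?thesis
      by (simp add: eq)
  qed
  from l2_dist_tendsto_0I[OF wfn wf this]
  have "(\<lambda>n. l2_dist M (wco M u \<phi> (ae_class M (fn n))) (ae_class M (wc f))) \<longlonglongrightarrow> 0"
    by (simp add: W)
  moreover have "range (\<lambda>n. wco M u \<phi> (ae_class M (fn n))) \<subseteq> wco M u \<phi> ` L2 M"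
    using fn by (auto intro: ae_class_in_L2)
  ultimately have "ae_class M (wc f) \<in> wco M u \<phi> ` L2 M"
    using closed ae_class_in_L2[OF wf] unfolding has_closed_range_def closedin_L2_iff by blast
  then obtain k where k: "k \<in> sq_integrable M" "ae_class M (wc f) = wco M u \<phi> (ae_class M k)"
    by (auto simp: L2_def)
  have [measurable]: "k \<in> borel_measurable M"
    using k by (simp add: sq_integrable_def)
  have "AE x in M. wc f x = wc k x"
    using k(2) by (simp add: wco_ae_class_eq ae_class_eq_iff)
  then have "l2_sq M (wc (\<lambda>x. f x - k x)) = 0"
    unfolding wc_diff l2_sq_def by (subst nn_integral_0_iff_AE) auto
  then have "AE x in M. ennreal ((cmod (f x - k x))\<^sup>2) * J x = 0"
    by (subst (asm) l2_sq_wc) (auto simp: nn_integral_0_iff_AE simp del: mult_eq_0_iff)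
  moreover have "AE x in M. g x * J x \<noteq> \<infinity>"
    by (rule nn_integral_PInf_AE) (use fin in auto)
  ultimately have "AE x in M. g x * indicator (supp M J) x \<le> ennreal ((cmod (k x))\<^sup>2)"
  proof eventually_elim
    case (elim x)
    show ?case
    proof (cases "x \<in> supp M J")
      case True
      then have "J x \<noteq> 0"
        by (simp add: supp_def)
      then have "f x = k x" and "g x \<noteq> \<infinity>"
        using elim by (auto simp: ennreal_top_mult)
      then show ?thesis
        using fsq[of x] by (auto simp: indicator_def)
    qed simp
  qed
  then have "(\<integral>\<^sup>+x. g x * indicator (supp M J) x \<partial>M) \<le> l2_sq M k"
    unfolding l2_sq_def by (rule nn_integral_mono_AE)
  then show ?thesis
    using k(1) by (auto simp: sq_integrable_iff_l2_sq)
qed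

lemma closed_range_imp_J_bounded_below:
  assumes closed: "has_closed_range M (wco M u \<phi>)"
  shows "\<exists>\<delta>>0. AE x in M. x \<in> supp M J \<longrightarrow> ennreal \<delta> \<le> J x"
proof (rule ccontr)
  assume neg: "\<not> ?thesis"
  obtain w where w [measurable]: "w \<in> borel_measurable M" and wfin: "integral\<^sup>N M w \<noteq> \<infinity>"
    and wpos: "\<And>x. x \<in> space M \<Longrightarrow> 0 < w x"
    using Ex_finite_integrable_function by blast
  \<comment> \<open>The \<open>k\<close>-th summand of \<open>g\<close> has unit mass and vanishes off \<open>D k\<close>: \<open>\<integral> g = \<infinity>\<close> over \<open>S(J)\<close>, but \<open>\<integral> g J \<le> \<Sum> 2\<^sup>-\<^sup>k\<close>.\<close>
  define D where "D k = {x \<in> supp M J. J x < ennreal ((1/2) ^ k)}" for k :: nat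
  define c where "c k = (\<integral>\<^sup>+x. w x * indicator (D k) x \<partial>M)" for k
  define g where "g x = (\<Sum>k. w x * indicator (D k) x / c k)" for x
  have D [measurable]: "D k \<in> sets M" for k
  proof -
    have "D k = supp M J \<inter> {x \<in> space M. J x < ennreal ((1/2) ^ k)}"
      by (auto simp: D_def supp_def)
    then show ?thesis
      by simp
  qed
  have c0: "c k \<noteq> 0" for k
  proof
    assume "c k = 0"
    then have "AE x in M. w x * indicator (D k) x = 0"
      unfolding c_def by (subst (asm) nn_integral_0_iff_AE) auto
    then have "AE x in M. x \<in> supp M J \<longrightarrow> ennreal ((1/2) ^ k) \<le> J x"
      using AE_space
    proof eventually_elim
      case (elim x)
      then show ?case
        using wpos[of x] by (cases "x \<in> D k") (auto simp: D_def not_le)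
    qed
    moreover have "(0::real) < (1/2) ^ k"
      by simp
    ultimately show False
      using neg by blast
  qed
  have "c k \<le> integral\<^sup>N M w" for k
    unfolding c_def by (intro nn_integral_mono) (auto simp: indicator_def)
  then have cfin: "c k \<noteq> \<infinity>" for k
    using wfin neq_top_trans by auto
  have one: "c k / c k = 1" for k
    using c0[of k] cfin[of k] by (simp add: less_top)
  have [measurable]: "g \<in> borel_measurable M"
    unfolding g_def[abs_def] by measurable
  have sum: "(\<integral>\<^sup>+x. g x * k x \<partial>M) = (\<Sum>j. \<integral>\<^sup>+x. w x * indicator (D j) x / c j * k x \<partial>M)"
    if [measurable]: "k \<in> borel_measurable M" for k
  proof -
    have "(\<integral>\<^sup>+x. g x * k x \<partial>M) = (\<integral>\<^sup>+x. (\<Sum>j. w x * indicator (D j) x / c j * k x) \<partial>M)"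
      unfolding g_def by (subst ennreal_suminf_multc) (rule refl)
    also have "\<dots> = (\<Sum>j. \<integral>\<^sup>+x. w x * indicator (D j) x / c j * k x \<partial>M)"
      by (rule nn_integral_suminf) measurable
    finally show ?thesis .
  qed
  have "(\<integral>\<^sup>+x. g x * J x \<partial>M) = (\<Sum>k. \<integral>\<^sup>+x. w x * indicator (D k) x / c k * J x \<partial>M)"
    by (rule sum) measurable
  also have "\<dots> \<le> (\<Sum>k. ennreal ((1/2) ^ k))"
  proof (intro suminf_le)
    fix k
    have "(\<integral>\<^sup>+x. w x * indicator (D k) x / c k * J x \<partial>M) \<le>
        (\<integral>\<^sup>+x. w x * indicator (D k) x / c k * ennreal ((1/2) ^ k) \<partial>M)"
      by (intro nn_integral_mono) (auto simp: D_def indicator_def intro!: mult_left_mono)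
    also have "\<dots> = c k / c k * ennreal ((1/2) ^ k)"
      by (simp add: nn_integral_multc nn_integral_divide c_def)
    finally show "(\<integral>\<^sup>+x. w x * indicator (D k) x / c k * J x \<partial>M) \<le> ennreal ((1/2) ^ k)"
      by (simp add: one)
  qed auto
  also have "\<dots> < \<infinity>"
    by (subst suminf_ennreal2) (auto intro: summable_geometric)
  finally have "(\<integral>\<^sup>+x. g x * indicator (supp M J) x \<partial>M) < \<infinity>"
    by (intro closed_range_imp_integrable[OF closed]) auto
  moreover have "(\<integral>\<^sup>+x. g x * indicator (supp M J) x \<partial>M) =
      (\<Sum>k. \<integral>\<^sup>+x. w x * indicator (D k) x / c k * indicator (supp M J) x \<partial>M)"
    by (rule sum) measurable
  moreover have "(\<integral>\<^sup>+x. w x * indicator (D k) x / c k * indicator (supp M J) x \<partial>M) = 1" for k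
  proof -
    have "(\<integral>\<^sup>+x. w x * indicator (D k) x / c k * indicator (supp M J) x \<partial>M) =
        (\<integral>\<^sup>+x. w x * indicator (D k) x / c k \<partial>M)"
      by (intro nn_integral_cong) (auto simp: D_def indicator_def)
    also have "\<dots> = 1"
      by (simp add: nn_integral_divide c_def[symmetric] one)
    finally show ?thesis .
  qed
  ultimately have "(\<Sum>k::nat. 1 :: ennreal) < \<infinity>"
    by simp
  then obtain n where "(\<Sum>k::nat. 1 :: ennreal) < of_nat n"
    using ennreal_Ex_less_of_nat by (auto simp: less_top)
  moreover have "of_nat n \<le> (\<Sum>k::nat. 1 :: ennreal)"
    using sum_le_suminf[OF summableI, of "{..<n}" "\<lambda>k. 1 :: ennreal"] by simp
  ultimately show False
    by simp
qed

lemma nn_integral_wco_J_ge: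
  assumes J: "AE x in M. x \<in> supp M J \<longrightarrow> ennreal \<delta> \<le> J x" and "0 < \<delta>"
    and inv: "AE x in M. \<phi> x \<in> supp M J \<longrightarrow> x \<in> supp M J"
    and [measurable]: "g \<in> borel_measurable M" and g: "\<And>x. x \<notin> supp M J \<Longrightarrow> g x = 0"
  shows "ennreal (\<delta> ^ n) * (\<integral>\<^sup>+x. g x \<partial>M) \<le> (\<integral>\<^sup>+x. g x * wco_J M u \<phi> n x \<partial>M)"
proof (induction n)
  case 0
  have "(\<integral>\<^sup>+x. g x * wco_J M u \<phi> 0 x \<partial>M) = (\<integral>\<^sup>+x. g x \<partial>M)"
    by (rule nn_integral_cong_AE) (use wco_J_0 in auto)
  then show ?case
    by simp
next
  case (Suc n)
  \<comment> \<open>The pull-back of a null set is null, so the a.e. invariance of \<open>S(J)\<close> can be iterated.\<close>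
  have inv_n: "AE x in M. (\<phi> ^^ n) x \<in> supp M J \<longrightarrow> x \<in> supp M J"
  proof (induction n)
    case (Suc n)
    from nonsingular_AE[OF nonsingular this] inv show ?case
      by eventually_elim (auto simp: funpow_swap1)
  qed simp
  have "ennreal (\<delta> ^ Suc n) * (\<integral>\<^sup>+x. g x \<partial>M) = ennreal \<delta> * (ennreal (\<delta> ^ n) * (\<integral>\<^sup>+x. g x \<partial>M))"
    using \<open>0 < \<delta>\<close> by (simp add: ennreal_mult mult.assoc)
  also have "\<dots> \<le> ennreal \<delta> * (\<integral>\<^sup>+x. g x * wco_J M u \<phi> n x \<partial>M)"
    by (intro mult_left_mono Suc) auto
  also have "\<dots> = (\<integral>\<^sup>+x. g ((\<phi> ^^ n) x) * ennreal ((weight u \<phi> n x)\<^sup>2) * ennreal \<delta> \<partial>M)"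
    by (subst nn_integral_multc) (auto simp: nn_integral_wco_J mult.commute)
  also have "\<dots> \<le> (\<integral>\<^sup>+x. g ((\<phi> ^^ n) x) * ennreal ((weight u \<phi> n x)\<^sup>2) * J x \<partial>M)"
  proof (rule nn_integral_mono_AE)
    from J inv_n show "AE x in M. g ((\<phi> ^^ n) x) * ennreal ((weight u \<phi> n x)\<^sup>2) * ennreal \<delta> \<le>
        g ((\<phi> ^^ n) x) * ennreal ((weight u \<phi> n x)\<^sup>2) * J x"
    proof eventually_elim
      case (elim x)
      then show ?case
        by (cases "(\<phi> ^^ n) x \<in> supp M J") (auto simp: g intro!: mult_left_mono)
    qed
  qed
  also have "\<dots> = (\<integral>\<^sup>+x. g x * wco_J M u \<phi> (Suc n) x \<partial>M)"
    by (rule nn_integral_wco_J_Suc[symmetric]) auto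
  finally show ?case .
qed

lemma wco_J_ge_power:
  assumes J: "AE x in M. x \<in> supp M J \<longrightarrow> ennreal \<delta> \<le> J x" and "0 < \<delta>"
    and inv: "AE x in M. \<phi> x \<in> supp M J \<longrightarrow> x \<in> supp M J"
  shows "AE x in M. x \<in> supp M J \<longrightarrow> ennreal (\<delta> ^ n) \<le> wco_J M u \<phi> n x"
proof (rule ccontr)
  assume neg: "\<not> ?thesis"
  obtain w where w [measurable]: "w \<in> borel_measurable M" and wfin: "integral\<^sup>N M w \<noteq> \<infinity>"
    and wpos: "\<And>x. x \<in> space M \<Longrightarrow> 0 < w x \<and> w x < \<infinity>"
    using Ex_finite_integrable_function by blast
  \<comment> \<open>The weight \<open>w\<close> makes the integrals over the exceptional set \<open>A\<close> finite, as strictness requires.\<close>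
  define A where "A = supp M J \<inter> {x \<in> space M. wco_J M u \<phi> n x < ennreal (\<delta> ^ n)}"
  define g where "g x = w x * indicator A x" for x
  have [measurable]: "A \<in> sets M"
    unfolding A_def by measurable
  have [measurable]: "g \<in> borel_measurable M"
    unfolding g_def[abs_def] by measurable
  have le: "g x * wco_J M u \<phi> n x \<le> g x * ennreal (\<delta> ^ n)" for x
    by (auto simp: g_def A_def indicator_def intro!: mult_left_mono)
  have fin: "(\<integral>\<^sup>+x. g x * ennreal (\<delta> ^ n) \<partial>M) < \<infinity>"
  proof -
    have "integral\<^sup>N M g \<le> integral\<^sup>N M w"
      by (intro nn_integral_mono) (auto simp: g_def indicator_def)
    then show ?thesis
      using wfin by (auto simp: nn_integral_multc ennreal_mult_less_top less_top top_unique)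
  qed
  have "(\<integral>\<^sup>+x. g x * wco_J M u \<phi> n x \<partial>M) < (\<integral>\<^sup>+x. g x * ennreal (\<delta> ^ n) \<partial>M)"
  proof (rule nn_integral_less)
    have "(\<integral>\<^sup>+x. g x * wco_J M u \<phi> n x \<partial>M) \<le> (\<integral>\<^sup>+x. g x * ennreal (\<delta> ^ n) \<partial>M)"
      by (intro nn_integral_mono le)
    then show "(\<integral>\<^sup>+x. g x * wco_J M u \<phi> n x \<partial>M) \<noteq> \<infinity>"
      using fin by auto
    show "\<not> (AE x in M. g x * ennreal (\<delta> ^ n) \<le> g x * wco_J M u \<phi> n x)"
    proof
      assume "AE x in M. g x * ennreal (\<delta> ^ n) \<le> g x * wco_J M u \<phi> n x"
      with AE_space have "AE x in M. x \<in> supp M J \<longrightarrow> ennreal (\<delta> ^ n) \<le> wco_J M u \<phi> n x"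
      proof eventually_elim
        case (elim x)
        show ?case
        proof (rule ccontr)
          assume "\<not> (x \<in> supp M J \<longrightarrow> ennreal (\<delta> ^ n) \<le> wco_J M u \<phi> n x)"
          then have "x \<in> A" and lt: "wco_J M u \<phi> n x < ennreal (\<delta> ^ n)"
            using elim by (auto simp: A_def)
          then have "w x * ennreal (\<delta> ^ n) \<le> w x * wco_J M u \<phi> n x"
            using elim by (simp add: g_def)
          then show False
            using lt wpos[of x] elim(1) ennreal_mult_strict_left_mono[OF lt, of "w x"]
            by auto
        qed
      qed
      then show False
        using neg by blast
    qed
  qed (use le in auto)
  also have "\<dots> = ennreal (\<delta> ^ n) * (\<integral>\<^sup>+x. g x \<partial>M)"
    by (simp add: nn_integral_multc mult.commute)
  also have "\<dots> \<le> (\<integral>\<^sup>+x. g x * wco_J M u \<phi> n x \<partial>M)"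
    by (rule nn_integral_wco_J_ge[OF assms \<open>g \<in> borel_measurable M\<close>])
      (auto simp: g_def A_def)
  finally show False
    by simp
qed

section \<open>Closed ranges of the powers\<close>

text \<open>An integrated form of \<open>J \<le> C\<close>, with \<open>C > 0\<close> so that the bound also holds when \<open>\<integral> g d\<mu> = \<infinity>\<close>.\<close>

lemma bounded_imp_J_bounded:
  assumes bdd: "bounded_l2_op M (wco M u \<phi>)"
  shows "\<exists>C>0. \<forall>g \<in> borel_measurable M. (\<integral>\<^sup>+x. g x * J x \<partial>M) \<le> ennreal C * (\<integral>\<^sup>+x. g x \<partial>M)"
proof -
  obtain K where K: "\<And>F. F \<in> L2 M \<Longrightarrow> l2_norm M (wco M u \<phi> F) \<le> K * l2_norm M F"
    and sub: "wco M u \<phi> ` L2 M \<subseteq> L2 M"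
    using bdd by (auto simp: bounded_l2_op_def)
  define C where "C = K\<^sup>2 + 1"
  have "0 < C"
    by (auto simp: C_def intro: add_nonneg_pos)
  have "(\<integral>\<^sup>+x. g x * J x \<partial>M) \<le> ennreal C * (\<integral>\<^sup>+x. g x \<partial>M)"
    if g [measurable]: "g \<in> borel_measurable M" for g
  proof (cases "(\<integral>\<^sup>+x. g x \<partial>M) = \<infinity>")
    case True
    then show ?thesis
      using \<open>0 < C\<close> by (simp add: ennreal_mult_top)
  next
    case False
    define f where "f x = complex_of_real (sqrt (enn2real (g x)))" for x
    have [measurable]: "f \<in> borel_measurable M"
      unfolding f_def[abs_def] by measurable
    have "AE x in M. g x \<noteq> \<infinity>"
      by (rule nn_integral_PInf_AE[OF g False])
    then have gf: "AE x in M. ennreal ((cmod (f x))\<^sup>2) = g x"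
      by eventually_elim (auto simp: f_def less_top)
    have If: "l2_sq M f = (\<integral>\<^sup>+x. g x \<partial>M)"
      unfolding l2_sq_def by (rule nn_integral_cong_AE) (use gf in auto)
    have f: "f \<in> sq_integrable M"
      using False by (auto simp: sq_integrable_iff_l2_sq If less_top)
    have W: "wco M u \<phi> (ae_class M f) = ae_class M (wc f)"
      by (rule wco_ae_class_eq) measurable
    then have "ae_class M (wc f) \<in> L2 M"
      using sub ae_class_in_L2[OF f] by force
    then obtain k where k: "k \<in> sq_integrable M" "ae_class M (wc f) = ae_class M k"
      by (rule L2_cases)
    have [measurable]: "k \<in> borel_measurable M"
      using k by (simp add: sq_integrable_def)
    have "AE x in M. wc f x = k x"
      using k(2) by (simp add: ae_class_eq_iff)
    then have Ik: "l2_sq M (wc f) = l2_sq M k"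
      unfolding l2_sq_def by (intro nn_integral_cong_AE) auto
    have "(\<integral>\<^sup>+x. g x * J x \<partial>M) = l2_sq M (wc f)"
      unfolding l2_sq_wc[OF \<open>f \<in> borel_measurable M\<close>]
      by (rule nn_integral_cong_AE) (use gf in auto)
    also have "\<dots> = ennreal ((l2_norm M (wco M u \<phi> (ae_class M f)))\<^sup>2)"
      unfolding Ik W k(2) by (rule l2_norm_ae_class[OF k(1), symmetric])
    also have "\<dots> \<le> ennreal ((K * l2_norm M (ae_class M f))\<^sup>2)"
      by (intro ennreal_leI power_mono K ae_class_in_L2 f) (simp add: l2_norm_def)
    also have "\<dots> \<le> ennreal (C * (l2_norm M (ae_class M f))\<^sup>2)"
      by (intro ennreal_leI) (simp add: C_def algebra_simps)
    also have "\<dots> = ennreal C * (\<integral>\<^sup>+x. g x \<partial>M)"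
      using \<open>0 < C\<close> by (simp add: ennreal_mult l2_norm_ae_class[OF f] If)
    finally show ?thesis .
  qed
  then show ?thesis
    using \<open>0 < C\<close> by blast
qed

lemma bounded_imp_J_finite:
  assumes bdd: "bounded_l2_op M (wco M u \<phi>)"
  shows "AE x in M. J x \<noteq> \<infinity>"
proof -
  obtain w where w [measurable]: "w \<in> borel_measurable M" and wfin: "integral\<^sup>N M w \<noteq> \<infinity>"
    and wpos: "\<And>x. x \<in> space M \<Longrightarrow> 0 < w x"
    using Ex_finite_integrable_function by blast
  obtain C where "(\<integral>\<^sup>+x. w x * J x \<partial>M) \<le> ennreal C * (\<integral>\<^sup>+x. w x \<partial>M)"
    using bounded_imp_J_bounded[OF bdd] w by blast
  also have "\<dots> < \<infinity>"
    using wfin by (simp add: ennreal_mult_less_top less_top)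
  finally have "AE x in M. w x * J x \<noteq> \<infinity>"
    by (intro nn_integral_PInf_AE) auto
  then show ?thesis
    using AE_space
  proof eventually_elim
    case (elim x)
    then show ?case
      using wpos[of x] by (auto simp: ennreal_mult_eq_top_iff)
  qed
qed

lemma wc_sq_integrable:
  assumes bdd: "bounded_l2_op M (wco M u \<phi>)" and f: "f \<in> sq_integrable M"
  shows "wc f \<in> sq_integrable M"
proof -
  obtain C where C: "\<And>g. g \<in> borel_measurable M \<Longrightarrow>
      (\<integral>\<^sup>+x. g x * J x \<partial>M) \<le> ennreal C * (\<integral>\<^sup>+x. g x \<partial>M)"
    using bounded_imp_J_bounded[OF bdd] by blast
  have [measurable]: "f \<in> borel_measurable M"
    using f by (simp add: sq_integrable_def)
  have "l2_sq M (wc f) \<le> ennreal C * l2_sq M f"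
    unfolding l2_sq_wc[OF \<open>f \<in> borel_measurable M\<close>] unfolding l2_sq_def by (rule C) measurable
  also have "\<dots> < \<infinity>"
    using f by (simp add: sq_integrable_iff_l2_sq ennreal_mult_less_top)
  finally show ?thesis
    by (simp add: sq_integrable_iff_l2_sq)
qed

lemma l2_dist_le_wco:
  assumes bdd: "bounded_l2_op M (wco M u \<phi>)"
    and "0 < \<delta>" and J: "AE x in M. ennreal \<delta> \<le> J x"
    and F: "F \<in> L2 M" and G: "G \<in> L2 M"
  shows "sqrt \<delta> * l2_dist M F G \<le> l2_dist M (wco M u \<phi> F) (wco M u \<phi> G)"
proof -
  obtain f where f: "f \<in> sq_integrable M" "F = ae_class M f"
    using F by (rule L2_cases)
  obtain g where g: "g \<in> sq_integrable M" "G = ae_class M g"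
    using G by (rule L2_cases)
  have [measurable]: "f \<in> borel_measurable M" "g \<in> borel_measurable M"
    using f g by (auto simp: sq_integrable_def)
  have "ennreal (\<delta> * (l2_dist M F G)\<^sup>2) = ennreal \<delta> * l2_sq M (\<lambda>x. f x - g x)"
    using \<open>0 < \<delta>\<close> by (simp add: ennreal_mult f g l2_dist_ae_class)
  also have "\<dots> = (\<integral>\<^sup>+x. ennreal ((cmod (f x - g x))\<^sup>2) * ennreal \<delta> \<partial>M)"
    unfolding l2_sq_def by (subst nn_integral_multc) (auto simp: mult.commute)
  also have "\<dots> \<le> (\<integral>\<^sup>+x. ennreal ((cmod (f x - g x))\<^sup>2) * J x \<partial>M)"
    by (rule nn_integral_mono_AE) (use J in \<open>eventually_elim, auto intro: mult_left_mono\<close>)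
  also have "\<dots> = l2_sq M (\<lambda>x. wc f x - wc g x)"
    by (subst wc_diff[symmetric], subst l2_sq_wc) measurable
  also have "\<dots> = ennreal ((l2_dist M (wco M u \<phi> F) (wco M u \<phi> G))\<^sup>2)"
    using f g by (simp add: wco_ae_class_eq l2_dist_ae_class wc_sq_integrable[OF bdd])
  finally have "\<delta> * (l2_dist M F G)\<^sup>2 \<le> (l2_dist M (wco M u \<phi> F) (wco M u \<phi> G))\<^sup>2"
    by simp
  then have "sqrt (\<delta> * (l2_dist M F G)\<^sup>2) \<le> sqrt ((l2_dist M (wco M u \<phi> F) (wco M u \<phi> G))\<^sup>2)"
    by (rule real_sqrt_le_mono)
  moreover have "0 \<le> l2_dist M F G" "0 \<le> l2_dist M (wco M u \<phi> F) (wco M u \<phi> G)"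
    by (auto simp: l2_dist_def)
  ultimately show ?thesis
    by (simp add: real_sqrt_mult)
qed

lemma closedin_image_wco:
  assumes bdd: "bounded_l2_op M (wco M u \<phi>)"
    and closed: "has_closed_range M (wco M u \<phi>)"
    and "0 < \<delta>" and J: "AE x in M. ennreal \<delta> \<le> J x"
    and S: "closedin (Metric_space.mtopology (L2 M) (l2_dist M)) S"
  shows "closedin (Metric_space.mtopology (L2 M) (l2_dist M)) (wco M u \<phi> ` S)"
  unfolding closedin_L2_iff
proof (intro conjI allI impI)
  have SL: "S \<subseteq> L2 M"
    using S by (simp add: closedin_L2_iff)
  show "wco M u \<phi> ` S \<subseteq> L2 M"
    using SL bdd by (auto simp: bounded_l2_op_def)
  fix \<sigma> :: "nat \<Rightarrow> ('a \<Rightarrow> complex) set" and l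
  assume \<sigma>: "range \<sigma> \<subseteq> wco M u \<phi> ` S" and l: "l \<in> L2 M"
    and lim: "(\<lambda>n. l2_dist M (\<sigma> n) l) \<longlonglongrightarrow> 0"
  have "\<exists>F \<in> S. \<sigma> n = wco M u \<phi> F" for n
    using \<sigma> by blast
  then obtain \<tau> where \<tau>: "\<And>n. \<tau> n \<in> S" "\<And>n. \<sigma> n = wco M u \<phi> (\<tau> n)"
    by metis
  have "range \<sigma> \<subseteq> wco M u \<phi> ` L2 M"
    using \<sigma> SL by blast
  then have "l \<in> wco M u \<phi> ` L2 M"
    using closed l lim unfolding has_closed_range_def closedin_L2_iff by blast
  then obtain F where F: "F \<in> L2 M" "l = wco M u \<phi> F"
    by blast
  have le: "l2_dist M (\<tau> n) F \<le> l2_dist M (\<sigma> n) l / sqrt \<delta>" for n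
    using l2_dist_le_wco[OF bdd \<open>0 < \<delta>\<close> J, of "\<tau> n" F] \<tau> SL F \<open>0 < \<delta>\<close>
    by (simp add: pos_le_divide_eq mult.commute subset_iff)
  have "(\<lambda>n. l2_dist M (\<sigma> n) l / sqrt \<delta>) \<longlonglongrightarrow> 0"
    using tendsto_divide[OF lim tendsto_const, of "sqrt \<delta>"] \<open>0 < \<delta>\<close> by simp
  then have "(\<lambda>n. l2_dist M (\<tau> n) F) \<longlonglongrightarrow> 0"
    by (rule Lim_null_comparison[rotated]) (use le in \<open>simp add: l2_dist_def\<close>)
  moreover have "range \<tau> \<subseteq> S"
    using \<tau>(1) by blast
  ultimately have "F \<in> S"
    using S F(1) unfolding closedin_L2_iff by blast
  then show "l \<in> wco M u \<phi> ` S"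
    using F(2) by blast
qed

lemma has_closed_range_wco_power:
  assumes bdd: "bounded_l2_op M (wco M u \<phi>)"
    and closed: "has_closed_range M (wco M u \<phi>)"
    and "0 < \<delta>" and J: "AE x in M. ennreal \<delta> \<le> J x"
  shows "has_closed_range M (wco M u \<phi> ^^ n)"
proof (induction n)
  case 0
  show ?case
    by (simp add: has_closed_range_def closedin_L2_iff)
next
  case (Suc n)
  from closedin_image_wco[OF assms Suc[unfolded has_closed_range_def]] show ?case
    by (simp add: has_closed_range_def image_comp)
qed

section \<open>The adjoint\<close>

text \<open>The relation \<open>\<langle>W f, g\<rangle> = \<langle>f, h\<rangle>\<close> for all \<open>f\<close> in \<open>L\<^sup>2\<close>, on representatives: \<open>h\<close> represents \<open>W\<^sup>* g\<close>
  once \<open>g\<close> and \<open>h\<close> are square integrable.\<close>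

definition adjoint_pair :: "('a \<Rightarrow> complex) \<Rightarrow> ('a \<Rightarrow> complex) \<Rightarrow> bool" where
  "adjoint_pair g h \<longleftrightarrow> (\<forall>f \<in> sq_integrable M.
     (\<integral>x. wc f x * cnj (g x) \<partial>M) = (\<integral>x. f x * cnj (h x) \<partial>M))"

lemma adjoint_pair_add:
  assumes bdd: "bounded_l2_op M (wco M u \<phi>)"
    and sq: "g \<in> sq_integrable M" "h \<in> sq_integrable M" "g' \<in> sq_integrable M" "h' \<in> sq_integrable M"
    and "adjoint_pair g h" and "adjoint_pair g' h'"
  shows "adjoint_pair (\<lambda>x. g x + g' x) (\<lambda>x. h x + h' x)"
  unfolding adjoint_pair_def
proof
  fix f assume f: "f \<in> sq_integrable M"
  note int = sq_integrable_mult[OF wc_sq_integrable[OF bdd f] sq_integrable_cnj]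
    sq_integrable_mult[OF f sq_integrable_cnj]
  show "(\<integral>x. wc f x * cnj (g x + g' x) \<partial>M) = (\<integral>x. f x * cnj (h x + h' x) \<partial>M)"
    using assms f by (simp add: distrib_left int adjoint_pair_def)
qed

lemma adjoint_pair_cmult:
  assumes "adjoint_pair g h"
  shows "adjoint_pair (\<lambda>x. c * g x) (\<lambda>x. c * h x)"
proof -
  have "(\<lambda>x. k x * cnj (c * l x)) = (\<lambda>x. cnj c * (k x * cnj (l x)))" for k l :: "'a \<Rightarrow> complex"
    by auto
  then show ?thesis
    using assms unfolding adjoint_pair_def by (auto simp only: integral_mult_right_zero)
qed

text \<open>The image under \<open>\<phi>\<close> of the measure with density \<open>u p\<close> has a density \<open>H\<close>, which satisfies the adjoint
  identity. By Cauchy-Schwarz and the bound on \<open>J\<close>, \<open>(\<integral> f H)\<^sup>2 \<le> K \<integral> f\<^sup>2\<close> for nonnegative \<open>f\<close>; testing with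
  truncations \<open>f\<close> of \<open>H\<close> gives \<open>(\<integral> f\<^sup>2)\<^sup>2 \<le> (\<integral> f H)\<^sup>2 \<le> K \<integral> f\<^sup>2\<close>, so \<open>\<integral> f\<^sup>2 \<le> K\<close>, and hence
  \<open>\<integral> H\<^sup>2 \<le> K\<close>. In particular \<open>H\<close> is finite a.e.\<close>

lemma adjoint_pair_nonneg:
  fixes p :: "'a \<Rightarrow> real"
  assumes bdd: "bounded_l2_op M (wco M u \<phi>)"
    and p: "(\<lambda>x. complex_of_real (p x)) \<in> sq_integrable M" and "\<And>x. 0 \<le> p x"
    and u: "\<And>x. x \<in> space M \<Longrightarrow> 0 \<le> u x"
  shows "\<exists>h \<in> sq_integrable M. adjoint_pair (\<lambda>x. complex_of_real (p x)) h"
proof -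
  have [measurable]: "p \<in> borel_measurable M"
    using p measurable_compose[of "\<lambda>x. complex_of_real (p x)" M borel Re borel]
    by (simp add: sq_integrable_def)
  have up: "AE x in M. 0 \<le> u x * p x"
    using AE_space by eventually_elim (use u assms(3) in auto)
  define \<nu> where "\<nu> = distr (density M (\<lambda>x. ennreal (u x * p x))) M \<phi>"
  define H where "H = RN_deriv M \<nu>"
  have [measurable]: "H \<in> borel_measurable M"
    by (simp add: H_def)
  have "absolutely_continuous M \<nu>"
    unfolding absolutely_continuous_def
  proof
    fix A assume A: "A \<in> null_sets M"
    then have "AE x in M. \<phi> x \<notin> A"
      by (intro nonsingular_AE[OF nonsingular] AE_not_in)
    then have "AE x in \<nu>. x \<notin> A"
      using A unfolding \<nu>_def by (subst AE_distr_iff) (auto simp: AE_density)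
    then show "A \<in> null_sets \<nu>"
      using A by (subst (asm) AE_iff_null_sets[symmetric]) (auto simp: \<nu>_def)
  qed
  then have dH: "density M H = \<nu>"
    unfolding H_def by (rule density_RN_deriv) (simp add: \<nu>_def)
  have HI: "(\<integral>\<^sup>+x. f x * H x \<partial>M) = (\<integral>\<^sup>+x. f (\<phi> x) * ennreal (u x * p x) \<partial>M)"
    if [measurable]: "f \<in> borel_measurable M" for f
  proof -
    have "(\<integral>\<^sup>+x. f x * H x \<partial>M) = (\<integral>\<^sup>+x. f x \<partial>\<nu>)"
      unfolding dH[symmetric] by (subst nn_integral_density) (auto simp: mult.commute)
    also have "\<dots> = (\<integral>\<^sup>+x. f (\<phi> x) * ennreal (u x * p x) \<partial>M)"
      unfolding \<nu>_def by (subst nn_integral_distr) (auto simp: nn_integral_density mult.commute)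
    finally show ?thesis .
  qed
  obtain C where "0 < C" and C: "\<And>g. g \<in> borel_measurable M \<Longrightarrow>
      (\<integral>\<^sup>+x. g x * J x \<partial>M) \<le> ennreal C * (\<integral>\<^sup>+x. g x \<partial>M)"
    using bounded_imp_J_bounded[OF bdd] by blast
  define K where "K = ennreal C * l2_sq M (\<lambda>x. complex_of_real (p x))"
  have "K < \<infinity>"
    using p by (auto simp: K_def sq_integrable_iff_l2_sq ennreal_mult_less_top)
  have CS: "(\<integral>\<^sup>+x. f x * H x \<partial>M)\<^sup>2 \<le> K * (\<integral>\<^sup>+x. (f x)\<^sup>2 \<partial>M)"
    if [measurable]: "f \<in> borel_measurable M" for f
  proof -
    have "(\<integral>\<^sup>+x. f x * H x \<partial>M) = (\<integral>\<^sup>+x. (f (\<phi> x) * ennreal (u x)) * ennreal (p x) \<partial>M)"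
      unfolding HI[OF that] using u assms(3)
      by (intro nn_integral_cong) (simp add: ennreal_mult mult.assoc)
    then have "(\<integral>\<^sup>+x. f x * H x \<partial>M)\<^sup>2 \<le>
        (\<integral>\<^sup>+x. (f (\<phi> x) * ennreal (u x))\<^sup>2 \<partial>M) * (\<integral>\<^sup>+x. (ennreal (p x))\<^sup>2 \<partial>M)"
      using Cauchy_Schwarz_nn_integral[of "\<lambda>x. f (\<phi> x) * ennreal (u x)" M "\<lambda>x. ennreal (p x)"]
      by simp
    also have "(\<integral>\<^sup>+x. (ennreal (p x))\<^sup>2 \<partial>M) = l2_sq M (\<lambda>x. complex_of_real (p x))"
      by (simp add: l2_sq_def ennreal_power assms(3))
    also have "(\<integral>\<^sup>+x. (f (\<phi> x) * ennreal (u x))\<^sup>2 \<partial>M) = (\<integral>\<^sup>+x. (f x)\<^sup>2 * J x \<partial>M)"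
      by (subst nn_integral_J, measurable, rule nn_integral_cong)
         (simp add: power_mult_distrib ennreal_power u)
    also have "\<dots> \<le> ennreal C * (\<integral>\<^sup>+x. (f x)\<^sup>2 \<partial>M)"
      by (rule C) measurable
    finally show ?thesis
      by (simp add: K_def mult_ac mult_right_mono)
  qed
  obtain w where w [measurable]: "w \<in> borel_measurable M" and wfin: "integral\<^sup>N M w \<noteq> \<infinity>"
    and wpos: "\<And>x. x \<in> space M \<Longrightarrow> 0 < w x \<and> w x < \<infinity>"
    using Ex_finite_integrable_function by blast
  \<comment> \<open>As \<open>v\<close> is positive and square integrable, the truncations \<open>min H (n v)\<close> are square integrable and tend to \<open>H\<close>.\<close>
  define v where "v x = sqrt (enn2real (w x))" for x
  have [measurable]: "v \<in> borel_measurable M"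
    unfolding v_def[abs_def] by measurable
  have v: "0 < v x" "(ennreal (v x))\<^sup>2 = w x" if "x \<in> space M" for x
    using wpos[OF that] by (auto simp: v_def ennreal_power enn2real_positive_iff)
  define f where "f n x = min (H x) (ennreal (real n * v x))" for n x
  have [measurable]: "f n \<in> borel_measurable M" for n
    unfolding f_def[abs_def] by measurable
  have fK: "(\<integral>\<^sup>+x. (f n x)\<^sup>2 \<partial>M) \<le> K" for n
  proof -
    let ?I = "\<integral>\<^sup>+x. (f n x)\<^sup>2 \<partial>M"
    have "?I \<le> (\<integral>\<^sup>+x. ennreal ((real n)\<^sup>2) * w x \<partial>M)"
    proof (rule nn_integral_mono)
      fix x assume x: "x \<in> space M"
      have "(f n x)\<^sup>2 \<le> (ennreal (real n * v x))\<^sup>2"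
        by (intro power_mono) (auto simp: f_def)
      also have "\<dots> = ennreal ((real n)\<^sup>2) * w x"
        using v(1)[OF x] unfolding v(2)[OF x, symmetric]
        by (simp add: ennreal_power power_mult_distrib ennreal_mult)
      finally show "(f n x)\<^sup>2 \<le> ennreal ((real n)\<^sup>2) * w x" .
    qed
    also have "\<dots> < \<infinity>"
      using wfin by (simp add: nn_integral_cmult ennreal_mult_less_top less_top)
    finally have fin: "?I < \<infinity>" .
    have "?I \<le> (\<integral>\<^sup>+x. f n x * H x \<partial>M)"
      by (intro nn_integral_mono) (auto simp: power2_eq_square f_def intro!: mult_left_mono)
    then have "?I\<^sup>2 \<le> (\<integral>\<^sup>+x. f n x * H x \<partial>M)\<^sup>2"
      by (rule power_mono) simp
    also have "\<dots> \<le> K * ?I"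
      by (rule CS) measurable
    finally have le: "?I * ?I \<le> K * ?I"
      by (simp add: power2_eq_square)
    show "?I \<le> K"
    proof (cases "?I = 0")
      case False
      show ?thesis
      proof (rule ccontr)
        assume "\<not> ?I \<le> K"
        then have "?I * K < ?I * ?I"
          using False fin by (intro ennreal_mult_strict_left_mono) (auto simp: zero_less_iff_neq_zero)
        then show False
          using le by (simp add: mult.commute)
      qed
    qed simp
  qed
  have HK: "(\<integral>\<^sup>+x. (H x)\<^sup>2 \<partial>M) \<le> K"
  proof -
    have "(\<integral>\<^sup>+x. (H x)\<^sup>2 \<partial>M) \<le> (\<integral>\<^sup>+x. liminf (\<lambda>n. (f n x)\<^sup>2) \<partial>M)"
    proof (rule nn_integral_mono)
      fix x assume x: "x \<in> space M"
      have "filterlim (\<lambda>n. real n * v x) at_top sequentially"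
        by (rule filterlim_at_top_mult_tendsto_pos[OF tendsto_const v(1)[OF x]
            filterlim_real_sequentially])
      then have "(\<lambda>n. ennreal (real n * v x)) \<longlonglongrightarrow> \<infinity>"
        by (simp add: ennreal_tendsto_top_eq_at_top)
      then have "(\<lambda>n. f n x) \<longlonglongrightarrow> min (H x) \<infinity>"
        unfolding f_def by (intro tendsto_min tendsto_const)
      then have "(\<lambda>n. f n x * f n x) \<longlonglongrightarrow> H x * H x"
        by (intro tendsto_mult_ennreal) auto
      then have "(\<lambda>n. (f n x)\<^sup>2) \<longlonglongrightarrow> (H x)\<^sup>2"
        by (simp add: power2_eq_square)
      then show "(H x)\<^sup>2 \<le> liminf (\<lambda>n. (f n x)\<^sup>2)"
        by (simp add: lim_imp_Liminf)
    qed
    also have "\<dots> \<le> liminf (\<lambda>n. \<integral>\<^sup>+x. (f n x)\<^sup>2 \<partial>M)"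
      by (rule nn_integral_liminf) measurable
    also have "\<dots> \<le> K"
      by (rule Liminf_le) (auto intro!: always_eventually fK)
    finally show ?thesis .
  qed
  define h where "h x = enn2real (H x)" for x
  have [measurable]: "h \<in> borel_measurable M"
    unfolding h_def[abs_def] by measurable
  have "AE x in M. (H x)\<^sup>2 \<noteq> \<infinity>"
    by (rule nn_integral_PInf_AE) (use HK \<open>K < \<infinity>\<close> in auto)
  then have hH: "AE x in M. ennreal (h x) = H x"
    by eventually_elim (auto simp: h_def less_top power2_eq_square ennreal_mult_eq_top_iff)
  have "l2_sq M (\<lambda>x. complex_of_real (h x)) = (\<integral>\<^sup>+x. (H x)\<^sup>2 \<partial>M)"
    unfolding l2_sq_def
    by (rule nn_integral_cong_AE) (use hH in \<open>eventually_elim, simp add: h_def ennreal_power[symmetric]\<close>)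
  then have "(\<lambda>x. complex_of_real (h x)) \<in> sq_integrable M"
    using HK \<open>K < \<infinity>\<close> by (auto simp: sq_integrable_iff_l2_sq)
  moreover have "adjoint_pair (\<lambda>x. complex_of_real (p x)) (\<lambda>x. complex_of_real (h x))"
    unfolding adjoint_pair_def
  proof
    fix f assume "f \<in> sq_integrable M"
    then have [measurable]: "f \<in> borel_measurable M"
      by (simp add: sq_integrable_def)
    have "density M (\<lambda>x. ennreal (h x)) = \<nu>"
      unfolding dH[symmetric] by (rule density_cong) (use hH in auto)
    have "(\<integral>x. f x * cnj (complex_of_real (h x)) \<partial>M) = (\<integral>x. h x *\<^sub>R f x \<partial>M)"
      by (simp add: scaleR_conv_of_real mult.commute)
    also have "\<dots> = (\<integral>x. f x \<partial>density M (\<lambda>x. ennreal (h x)))"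
      by (rule integral_density[symmetric]) (auto simp: h_def)
    also have "\<dots> = (\<integral>x. f x \<partial>\<nu>)"
      by (simp only: \<open>density M (\<lambda>x. ennreal (h x)) = \<nu>\<close>)
    also have "\<dots> = (\<integral>x. f (\<phi> x) \<partial>density M (\<lambda>x. ennreal (u x * p x)))"
      unfolding \<nu>_def by (rule integral_distr) auto
    also have "\<dots> = (\<integral>x. (u x * p x) *\<^sub>R f (\<phi> x) \<partial>M)"
      by (rule integral_density) (use up in auto)
    also have "\<dots> = (\<integral>x. wc f x * cnj (complex_of_real (p x)) \<partial>M)"
      by (simp add: wc_def scaleR_conv_of_real mult_ac)
    finally show "(\<integral>x. wc f x * cnj (complex_of_real (p x)) \<partial>M) =
        (\<integral>x. f x * cnj (complex_of_real (h x)) \<partial>M)" ..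
  qed
  ultimately show ?thesis
    by blast
qed

lemma ex_adjoint_pair:
  assumes bdd: "bounded_l2_op M (wco M u \<phi>)"
    and u: "\<And>x. x \<in> space M \<Longrightarrow> 0 \<le> u x" and g: "g \<in> sq_integrable M"
  shows "\<exists>h \<in> sq_integrable M. adjoint_pair g h"
proof -
  have [measurable]: "g \<in> borel_measurable M"
    using g by (simp add: sq_integrable_def)
  have part: "\<exists>h \<in> sq_integrable M. adjoint_pair (\<lambda>x. complex_of_real (max 0 (r x))) h"
    "(\<lambda>x. complex_of_real (max 0 (r x))) \<in> sq_integrable M"
    if [measurable]: "r \<in> borel_measurable M" and le: "\<And>x. \<bar>r x\<bar> \<le> cmod (g x)" for r :: "'a \<Rightarrow> real"
  proof -
    show sq: "(\<lambda>x. complex_of_real (max 0 (r x))) \<in> sq_integrable M"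
      by (rule sq_integrable_bound[OF g], measurable) (use le abs_le_iff in \<open>auto simp: max_def\<close>)
    show "\<exists>h \<in> sq_integrable M. adjoint_pair (\<lambda>x. complex_of_real (max 0 (r x))) h"
      by (rule adjoint_pair_nonneg[OF bdd sq _ u]) auto
  qed
  let ?A = "\<lambda>g. g \<in> sq_integrable M \<and> (\<exists>h \<in> sq_integrable M. adjoint_pair g h)"
  have add: "?A (\<lambda>x. k x + l x)" if "?A k" "?A l" for k l
    using that sq_integrable_add adjoint_pair_add[OF bdd] by metis
  have cmult: "?A (\<lambda>x. c * k x)" if "?A k" for c k
    using that sq_integrable_cmult adjoint_pair_cmult by metis
  have A: "?A (\<lambda>x. complex_of_real (max 0 (r x)))"
    if "r \<in> borel_measurable M" "\<And>x. \<bar>r x\<bar> \<le> cmod (g x)" for r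
    using part[OF that] by blast
  \<comment> \<open>Split \<open>g\<close> into the positive and negative parts of its real and imaginary parts.\<close>
  have "?A (\<lambda>x. (complex_of_real (max 0 (Re (g x))) + (- 1) * complex_of_real (max 0 (- Re (g x)))) +
      (\<i> * complex_of_real (max 0 (Im (g x))) + (- \<i>) * complex_of_real (max 0 (- Im (g x)))))"
    by (intro add cmult A) (auto simp: abs_Re_le_cmod abs_Im_le_cmod)
  moreover have "(complex_of_real (max 0 (Re z)) + (- 1) * complex_of_real (max 0 (- Re z))) +
      (\<i> * complex_of_real (max 0 (Im z)) + (- \<i>) * complex_of_real (max 0 (- Im z))) = z" for z
    by (simp add: complex_eq_iff max_def)
  ultimately show ?thesis
    by simp
qed

lemma l2_adjoint_wco:
  assumes g: "g \<in> sq_integrable M" and h: "h \<in> sq_integrable M" and gh: "adjoint_pair g h"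
  shows "l2_adjoint M (wco M u \<phi>) (ae_class M g) = ae_class M h"
  unfolding l2_adjoint_def
proof (rule the_equality)
  have [measurable]: "g \<in> borel_measurable M" "h \<in> borel_measurable M"
    using g h by (auto simp: sq_integrable_def)
  have eq: "l2_inner M (wco M u \<phi> F) (ae_class M g) = l2_inner M F (ae_class M h)" if "F \<in> L2 M" for F
  proof -
    obtain f where f: "f \<in> sq_integrable M" "F = ae_class M f"
      using \<open>F \<in> L2 M\<close> by (rule L2_cases)
    then have [measurable]: "f \<in> borel_measurable M"
      by (simp add: sq_integrable_def)
    show ?thesis
      using f gh by (simp add: wco_ae_class_eq l2_inner_ae_class adjoint_pair_def)
  qed
  then show "ae_class M h \<in> L2 M \<and>
      (\<forall>F \<in> L2 M. l2_inner M (wco M u \<phi> F) (ae_class M g) = l2_inner M F (ae_class M h))"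
    using ae_class_in_L2[OF h] by blast
  show "H = ae_class M h" if "H \<in> L2 M \<and>
      (\<forall>F \<in> L2 M. l2_inner M (wco M u \<phi> F) (ae_class M g) = l2_inner M F H)" for H
    by (rule l2_inner_eqD) (use that eq ae_class_in_L2[OF h] in auto)
qed

text \<open>The identity \<open>\<langle>W f, W k\<rangle> = \<langle>f, J k\<rangle>\<close>, that is, \<open>W\<^sup>* W\<close> is multiplication by \<open>J\<close>.\<close>

lemma integral_wc_mult_cnj:
  assumes [measurable]: "f \<in> borel_measurable M" "k \<in> borel_measurable M"
    and fin: "AE x in M. J x \<noteq> \<infinity>"
  shows "(\<integral>x. wc f x * cnj (wc k x) \<partial>M) = (\<integral>x. f x * cnj (complex_of_real (enn2real (J x)) * k x) \<partial>M)"
proof -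
  let ?\<nu> = "distr (density M (\<lambda>x. ennreal ((u x)\<^sup>2))) M \<phi>"
  have "density M J = ?\<nu>"
    using density_wco_J[OF nonsingular measurable_u, of 1] by (simp add: J_def weight_def)
  moreover have "density M (\<lambda>x. ennreal (enn2real (J x))) = density M J"
    by (rule density_cong) (use fin in \<open>auto simp: less_top\<close>)
  ultimately have dJ: "density M (\<lambda>x. ennreal (enn2real (J x))) = ?\<nu>"
    by simp
  have "(\<integral>x. f x * cnj (complex_of_real (enn2real (J x)) * k x) \<partial>M) =
      (\<integral>x. enn2real (J x) *\<^sub>R (f x * cnj (k x)) \<partial>M)"
    by (simp add: scaleR_conv_of_real mult_ac)
  also have "\<dots> = (\<integral>x. f x * cnj (k x) \<partial>density M (\<lambda>x. ennreal (enn2real (J x))))"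
    by (rule integral_density[symmetric]) auto
  also have "\<dots> = (\<integral>x. f (\<phi> x) * cnj (k (\<phi> x)) \<partial>density M (\<lambda>x. ennreal ((u x)\<^sup>2)))"
    unfolding dJ by (rule integral_distr) auto
  also have "\<dots> = (\<integral>x. (u x)\<^sup>2 *\<^sub>R (f (\<phi> x) * cnj (k (\<phi> x))) \<partial>M)"
    by (rule integral_density) auto
  also have "\<dots> = (\<integral>x. wc f x * cnj (wc k x) \<partial>M)"
    by (simp add: wc_def scaleR_conv_of_real power2_eq_square mult_ac)
  finally show ?thesis ..
qed

lemma l2_adjoint_surj:
  assumes bdd: "bounded_l2_op M (wco M u \<phi>)"
    and u: "\<And>x. x \<in> space M \<Longrightarrow> 0 \<le> u x"
    and "0 < \<delta>" and J: "AE x in M. ennreal \<delta> \<le> J x"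
  shows "l2_adjoint M (wco M u \<phi>) ` L2 M = L2 M"
proof
  show "l2_adjoint M (wco M u \<phi>) ` L2 M \<subseteq> L2 M"
  proof
    fix H assume "H \<in> l2_adjoint M (wco M u \<phi>) ` L2 M"
    then obtain g where g: "g \<in> sq_integrable M" "H = l2_adjoint M (wco M u \<phi>) (ae_class M g)"
      by (auto simp: L2_def)
    then show "H \<in> L2 M"
      using ex_adjoint_pair[OF bdd u g(1)] l2_adjoint_wco ae_class_in_L2 by metis
  qed
  show "L2 M \<subseteq> l2_adjoint M (wco M u \<phi>) ` L2 M"
  proof
    fix H assume "H \<in> L2 M"
    then obtain h where h: "h \<in> sq_integrable M" "H = ae_class M h"
      by (rule L2_cases)
    have [measurable]: "h \<in> borel_measurable M"
      using h by (simp add: sq_integrable_def)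
    have fin: "AE x in M. J x \<noteq> \<infinity>"
      by (rule bounded_imp_J_finite[OF bdd])
    \<comment> \<open>This is \<open>h / J\<close>; the maximum with \<open>\<delta>\<close>, vacuous a.e., makes the bound \<open>|k| \<le> |h| / \<delta>\<close> hold everywhere.\<close>
    define k where "k x = h x / complex_of_real (max \<delta> (enn2real (J x)))" for x
    have [measurable]: "k \<in> borel_measurable M"
      unfolding k_def[abs_def] by measurable
    have k: "k \<in> sq_integrable M"
    proof (rule sq_integrable_bound[OF sq_integrable_cmult[OF h(1), of "complex_of_real (1 / \<delta>)"]])
      fix x
      have "cmod (h x) / max \<delta> (enn2real (J x)) \<le> cmod (h x) / \<delta>"
        using \<open>0 < \<delta>\<close> by (intro divide_left_mono) auto
      then show "cmod (k x) \<le> cmod (complex_of_real (1 / \<delta>) * h x)"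
        using \<open>0 < \<delta>\<close> by (simp add: k_def norm_divide norm_mult)
    qed simp
    have kh: "AE x in M. complex_of_real (enn2real (J x)) * k x = h x"
      using J fin
    proof eventually_elim
      case (elim x)
      then have "\<delta> \<le> enn2real (J x)"
        by (cases "J x") auto
      then show ?case
        using \<open>0 < \<delta>\<close> by (simp add: k_def max_absorb2)
    qed
    have "adjoint_pair (wc k) h"
      unfolding adjoint_pair_def
    proof
      fix f assume "f \<in> sq_integrable M"
      then have [measurable]: "f \<in> borel_measurable M"
        by (simp add: sq_integrable_def)
      have "(\<integral>x. wc f x * cnj (wc k x) \<partial>M) = (\<integral>x. f x * cnj (complex_of_real (enn2real (J x)) * k x) \<partial>M)"
        by (rule integral_wc_mult_cnj[OF _ _ fin]) measurable
      also have "\<dots> = (\<integral>x. f x * cnj (h x) \<partial>M)"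
      proof (rule integral_cong_AE)
        show "AE x in M. f x * cnj (complex_of_real (enn2real (J x)) * k x) = f x * cnj (h x)"
          using kh by eventually_elim (simp only:)
      qed measurable
      finally show "(\<integral>x. wc f x * cnj (wc k x) \<partial>M) = (\<integral>x. f x * cnj (h x) \<partial>M)" .
    qed
    from l2_adjoint_wco[OF wc_sq_integrable[OF bdd k] h(1) this]
    show "H \<in> l2_adjoint M (wco M u \<phi>) ` L2 M"
      using h(2) ae_class_in_L2[OF wc_sq_integrable[OF bdd k]] by (metis image_eqI)
  qed
qed

lemma has_closed_range_l2_adjoint_power:
  assumes bdd: "bounded_l2_op M (wco M u \<phi>)"
    and u: "\<And>x. x \<in> space M \<Longrightarrow> 0 \<le> u x"
    and "0 < \<delta>" and J: "AE x in M. ennreal \<delta> \<le> J x"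
  shows "has_closed_range M (l2_adjoint M (wco M u \<phi>) ^^ n)"
proof -
  have "(l2_adjoint M (wco M u \<phi>) ^^ n) ` L2 M = L2 M"
  proof (induction n)
    case (Suc n)
    then show ?case
      using l2_adjoint_surj[OF assms] by (simp only: funpow.simps image_comp[symmetric])
  qed simp
  then show ?thesis
    by (simp add: has_closed_range_def closedin_L2_iff)
qed

end

theorem theorem3p3:
  fixes M :: "'a measure" and \<phi> :: "'a \<Rightarrow> 'a" and u :: "'a \<Rightarrow> real"
  assumes "sigma_finite_measure M"
    and "nonsingular M \<phi>"
    and "u \<in> borel_measurable M"
    and "\<And>x. x \<in> space M \<Longrightarrow> 0 \<le> u x"
    and "bounded_l2_op M (wco M u \<phi>)"
    and "has_closed_range M (wco M u \<phi>)"
    and "AE x in M. x \<in> \<phi> -` supp M (wco_J M u \<phi> 1) \<longrightarrow> x \<in> supp M (wco_J M u \<phi> 1)"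
  shows "(\<exists>\<delta>>0. \<forall>n. AE x in M. x \<in> supp M (wco_J M u \<phi> 1) \<longrightarrow>
             ennreal (\<delta> ^ n) \<le> wco_J M u \<phi> n x) \<and>
         ((AE x in M. x \<in> supp M (wco_J M u \<phi> 1)) \<longrightarrow>
           (\<forall>n. has_closed_range M (wco M u \<phi> ^^ n) \<and>
                has_closed_range M (l2_adjoint M (wco M u \<phi>) ^^ n)))"
proof -
  interpret weighted_composition M u \<phi>
    using assms(1-3) by (simp add: weighted_composition_def weighted_composition_axioms_def)
  obtain \<delta> where "0 < \<delta>" and \<delta>: "AE x in M. x \<in> supp M J \<longrightarrow> ennreal \<delta> \<le> J x"
    using closed_range_imp_J_bounded_below[OF assms(6)] by blast
  have "AE x in M. \<phi> x \<in> supp M J \<longrightarrow> x \<in> supp M J"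
    using assms(7) by (simp add: J_def)
  from wco_J_ge_power[OF \<delta> \<open>0 < \<delta>\<close> this]
  have "\<exists>\<delta>>0. \<forall>n. AE x in M. x \<in> supp M J \<longrightarrow> ennreal (\<delta> ^ n) \<le> wco_J M u \<phi> n x"
    using \<open>0 < \<delta>\<close> by blast
  moreover have "has_closed_range M (wco M u \<phi> ^^ n) \<and>
      has_closed_range M (l2_adjoint M (wco M u \<phi>) ^^ n)"
    if "AE x in M. x \<in> supp M J" for n
  proof -
    have "AE x in M. ennreal \<delta> \<le> J x"
      using that \<delta> by eventually_elim simp
    then show ?thesis
      using has_closed_range_wco_power[OF assms(5,6) \<open>0 < \<delta>\<close>]
        has_closed_range_l2_adjoint_power[OF assms(5,4) \<open>0 < \<delta>\<close>] by blast
  qed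
  ultimately show ?thesis
    unfolding J_def by blast
qed

end
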